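(* For every integer $k\ge 0$, the Todd symmetric function $T_k$ is expressed in terms of the forgotten symmetric functions $f_\lambda$ by $$T_k=\sum_{\lambda:\ |\lambda|=k}\frac{f_\lambda}{(\lambda_1+1)!\cdots(\lambda_l+1)!},$$ where the sum is over all partitions $\lambda=(\lambda_1,\dots,\lambda_l)$ of $k$.
   Context: Let $\Lambda$ be the graded ring of symmetric functions over $\mathbb Z$ in variables $x_1,x_2,\dots$, with elementary symmetric functions $e_k$, complete symmetric functions $h_k$ and monomial symmetric functions $m_\lambda$ ($\lambda$ a partition). Let $\omega:\Lambda\to\Lambda$ be the standard ring involution determined by $\omega(e_k)=h_k$ for all $k$ (extended $\mathbb Q$-linearly to $\Lambda\otimes\mathbb Q$). The forgotten symmetric functions are $f_\lambda=\omega(m_\lambda)$ (Macdonald's sign convention). The Todd polynomials $T_k(c_1,\dots,c_n)$ are defined by $$\prod_{i=1}^n\frac{tx_i}{1-e^{-tx_i}}=\sum_{k\ge0}T_k(c_1,\dots,c_n)\,t^k,$$ where $c_j=e_j(x_1,\dots,x_n)$. The Todd symmetric function $T_k\in\Lambda^k\otimes\mathbb Q$ is the unique homogeneous symmetric function of degree $k$ with rational coefficients whose image under setting $x_i=0$ for all $i>k$ is the Todd polynomial $T_k(c_1,\dots,c_k)$ with $c_j=e_j(x_1,\dots,x_k)$. A partition of $k$ is a weakly decreasing finite sequence of positive integers with sum $|\lambda|=k$. *)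

theory Defs
  imports "HOL-Library.Poly_Mapping" "HOL-Library.Multiset"
    "HOL-Computational_Algebra.Formal_Power_Series"
begin

section \<open>Monomials\<close>

text \<open>
  A monomial in countably many variables is its finitely supported exponent vector; the variable
  $x_{i+1}$ has index \<open>i\<close>, and multiplication of monomials is addition of exponent vectors.
\<close>

type_synonym monom = "nat \<Rightarrow>\<^sub>0 nat"

definition mdeg :: "monom \<Rightarrow> nat" where
  "mdeg m = (\<Sum>i\<in>Poly_Mapping.keys m. Poly_Mapping.lookup m i)"

lemma mdeg_superset:
  assumes "finite A" "Poly_Mapping.keys m \<subseteq> A"
  shows "mdeg m = (\<Sum>i\<in>A. Poly_Mapping.lookup m i)"
  unfolding mdeg_def by (rule sum.mono_neutral_left) (use assms in \<open>auto simp: in_keys_iff\<close>)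

lemma mdeg_zero [simp]: "mdeg 0 = 0"
  by (simp add: mdeg_def)

lemma mdeg_add: "mdeg (a + b) = mdeg a + mdeg b"
proof -
  let ?A = "Poly_Mapping.keys a \<union> Poly_Mapping.keys b"
  have "Poly_Mapping.keys (a + b) \<subseteq> ?A"
    by (rule Poly_Mapping.keys_add)
  then have "mdeg (a + b) = (\<Sum>i\<in>?A. Poly_Mapping.lookup (a + b) i)"
    by (intro mdeg_superset) auto
  also have "\<dots> = (\<Sum>i\<in>?A. Poly_Mapping.lookup a i) + (\<Sum>i\<in>?A. Poly_Mapping.lookup b i)"
    by (simp add: lookup_add sum.distrib)
  also have "\<dots> = mdeg a + mdeg b"
    by (subst (1 2) mdeg_superset[where A = ?A]) auto
  finally show ?thesis .
qed

lemma lookup_le_mdeg: "Poly_Mapping.lookup m i \<le> mdeg m"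
proof (cases "i \<in> Poly_Mapping.keys m")
  case True
  then show ?thesis unfolding mdeg_def by (intro member_le_sum) auto
next
  case False
  then show ?thesis by (simp add: in_keys_iff)
qed

lemma finite_monoms_bounded:
  assumes "finite A"
  shows "finite {m :: monom. Poly_Mapping.keys m \<subseteq> A \<and> mdeg m \<le> d}" (is "finite ?S")
proof (rule finite_imageD)
  have "Poly_Mapping.lookup ` ?S \<subseteq> {f. \<forall>i. (i \<in> A \<longrightarrow> f i \<in> {..d}) \<and> (i \<notin> A \<longrightarrow> f i = 0)}"
  proof clarify
    fix m i assume "Poly_Mapping.keys m \<subseteq> A" "mdeg m \<le> d"
    then show "(i \<in> A \<longrightarrow> Poly_Mapping.lookup m i \<in> {..d}) \<and> (i \<notin> A \<longrightarrow> Poly_Mapping.lookup m i = 0)"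
      using le_trans[OF lookup_le_mdeg[of m i]] by (auto simp: in_keys_iff)
  qed
  then show "finite (Poly_Mapping.lookup ` ?S)"
    by (rule finite_subset) (rule finite_set_of_finite_funs[OF assms finite_atMost])
  show "inj_on Poly_Mapping.lookup ?S"
    by (auto intro: inj_onI simp: poly_mapping_eqI)
qed

lemma finite_add_decomps: "finite {(a, b). a + b = (m :: monom)}" (is "finite ?D")
proof -
  let ?S = "{a :: monom. Poly_Mapping.keys a \<subseteq> Poly_Mapping.keys m \<and> mdeg a \<le> mdeg m}"
  have "finite ?S" by (rule finite_monoms_bounded) simp
  moreover have "?D \<subseteq> ?S \<times> ?S"
    by (auto simp: mdeg_add in_keys_iff lookup_add)
  ultimately show ?thesis
    by (meson finite_SigmaI finite_subset)
qed

text \<open>The variables are permuted through the library's reindexing \<open>Poly_Mapping.map_key\<close>.\<close>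

lemma lookup_map_key_bij:
  "bij p \<Longrightarrow> Poly_Mapping.lookup (Poly_Mapping.map_key p m) i = Poly_Mapping.lookup m (p i)"
  by (simp add: map_key.rep_eq bij_is_inj)

lemma keys_map_key_bij:
  "bij p \<Longrightarrow> Poly_Mapping.keys (Poly_Mapping.map_key p m) = p -` Poly_Mapping.keys m"
  by (auto simp: in_keys_iff lookup_map_key_bij)

lemma bij_betw_keys_map_key:
  assumes "bij p"
  shows "bij_betw p (Poly_Mapping.keys (Poly_Mapping.map_key p m)) (Poly_Mapping.keys m)"
  unfolding keys_map_key_bij[OF assms]
proof (rule bij_betw_imageI)
  show "inj_on p (p -` Poly_Mapping.keys m)"
    by (rule inj_on_subset[OF bij_is_inj[OF assms] subset_UNIV])
  show "p ` p -` Poly_Mapping.keys m = Poly_Mapping.keys m"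
    by (rule surj_image_vimage_eq[OF bij_is_surj[OF assms]])
qed

lemma mdeg_map_key:
  assumes "bij p"
  shows "mdeg (Poly_Mapping.map_key p m) = mdeg m"
proof -
  have "mdeg (Poly_Mapping.map_key p m) =
      (\<Sum>i\<in>Poly_Mapping.keys (Poly_Mapping.map_key p m). Poly_Mapping.lookup m (p i))"
    unfolding mdeg_def by (rule sum.cong) (simp_all add: lookup_map_key_bij[OF assms])
  also have "\<dots> = mdeg m"
    unfolding mdeg_def by (rule sum.reindex_bij_betw[OF bij_betw_keys_map_key[OF assms]])
  finally show ?thesis .
qed

lemma map_key_add_bij:
  "bij p \<Longrightarrow> Poly_Mapping.map_key p (a + b :: monom) =
     Poly_Mapping.map_key p a + Poly_Mapping.map_key p b"
  by (intro poly_mapping_eqI) (simp add: lookup_map_key_bij lookup_add)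

lemma map_key_inv_bij:
  assumes "bij p"
  shows "Poly_Mapping.map_key p (Poly_Mapping.map_key (inv p) m) = m"
    and "Poly_Mapping.map_key (inv p) (Poly_Mapping.map_key p m) = m"
proof -
  have p': "bij (inv p)" using assms by (rule bij_imp_bij_inv)
  show "Poly_Mapping.map_key p (Poly_Mapping.map_key (inv p) m) = m"
    by (rule poly_mapping_eqI)
       (simp only: lookup_map_key_bij[OF assms] lookup_map_key_bij[OF p'] inv_f_f[OF bij_is_inj[OF assms]])
  show "Poly_Mapping.map_key (inv p) (Poly_Mapping.map_key p m) = m"
    by (rule poly_mapping_eqI)
       (simp only: lookup_map_key_bij[OF assms] lookup_map_key_bij[OF p'] surj_f_inv_f[OF bij_is_surj[OF assms]])
qed

section \<open>The ring of symmetric functions\<close>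

text \<open>
  A symmetric function over \<open>'a\<close> is a formal sum of monomials, given by its coefficients, of
  bounded degree and invariant under all permutations of the variables.  So \<^typ>\<open>int\<close> as
  coefficient type gives $\Lambda$, and \<^typ>\<open>rat\<close> gives $\Lambda \otimes \mathbb{Q}$.
\<close>

definition is_symfun :: "(monom \<Rightarrow> 'a :: zero) \<Rightarrow> bool" where
  "is_symfun f \<longleftrightarrow>
     (\<exists>d. \<forall>m. f m \<noteq> 0 \<longrightarrow> mdeg m \<le> d) \<and>
     (\<forall>p m. bij p \<longrightarrow> f (Poly_Mapping.map_key p m) = f m)"

lemma is_symfunI:
  assumes "\<And>m. f m \<noteq> 0 \<Longrightarrow> mdeg m \<le> d"
    and "\<And>p m. bij p \<Longrightarrow> f (Poly_Mapping.map_key p m) = f m"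
  shows "is_symfun f"
  using assms unfolding is_symfun_def by blast

lemma is_symfun_bounded:
  assumes "is_symfun f"
  obtains d where "\<And>m. f m \<noteq> 0 \<Longrightarrow> mdeg m \<le> d"
  using assms unfolding is_symfun_def by blast

lemma is_symfun_map_key: "is_symfun f \<Longrightarrow> bij p \<Longrightarrow> f (Poly_Mapping.map_key p m) = f m"
  unfolding is_symfun_def by blast

typedef (overloaded) 'a symfun = "{f :: monom \<Rightarrow> 'a :: zero. is_symfun f}"
  morphisms mcoeff Abs_symfun
  by (rule exI[of _ "\<lambda>_. 0"]) (simp add: is_symfun_def)

lemma is_symfun_mcoeff: "is_symfun (mcoeff f)"
  using mcoeff[of f] by simp

lemma mcoeff_map_key: "bij p \<Longrightarrow> mcoeff f (Poly_Mapping.map_key p m) = mcoeff f m"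
  by (rule is_symfun_map_key[OF is_symfun_mcoeff])

lemma mcoeff_bounded:
  obtains d where "\<And>m. mcoeff f m \<noteq> 0 \<Longrightarrow> mdeg m \<le> d"
  by (rule is_symfun_bounded[OF is_symfun_mcoeff[of f]]) blast

lemma mcoeff_Abs_symfun: "is_symfun f \<Longrightarrow> mcoeff (Abs_symfun f) = f"
  by (simp add: Abs_symfun_inverse)

lemma symfun_eqI: "(\<And>m. mcoeff f m = mcoeff g m) \<Longrightarrow> f = g"
  by (simp add: mcoeff_inject[symmetric] fun_eq_iff)

lemma mdeg_eq_0_iff: "mdeg m = 0 \<longleftrightarrow> m = 0"
  by (auto simp: mdeg_def in_keys_iff intro!: poly_mapping_eqI)

instantiation symfun :: (zero) zero
begin
definition zero_symfun :: "'a symfun" where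
  "zero_symfun = Abs_symfun (\<lambda>_. 0)"
instance ..
end

lemma mcoeff_zero [simp]: "mcoeff 0 m = 0"
  by (simp add: zero_symfun_def mcoeff_Abs_symfun is_symfun_def)

instantiation symfun :: (zero_neq_one) one
begin
definition one_symfun :: "'a symfun" where
  "one_symfun = Abs_symfun (\<lambda>m. if m = 0 then 1 else 0)"
instance ..
end

lemma mcoeff_one: "mcoeff 1 m = (if m = 0 then 1 else 0 :: 'a :: zero_neq_one)"
proof -
  have "is_symfun (\<lambda>m. if m = 0 then 1 else 0 :: 'a)"
    by (rule is_symfunI[where d = 0])
       (auto simp: mdeg_eq_0_iff[symmetric] mdeg_map_key split: if_splits)
  then show ?thesis by (simp add: one_symfun_def mcoeff_Abs_symfun)
qed

instantiation symfun :: (comm_ring_1) comm_ring_1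
begin

definition plus_symfun :: "'a symfun \<Rightarrow> 'a symfun \<Rightarrow> 'a symfun" where
  "plus_symfun f g = Abs_symfun (\<lambda>m. mcoeff f m + mcoeff g m)"

definition uminus_symfun :: "'a symfun \<Rightarrow> 'a symfun" where
  "uminus_symfun f = Abs_symfun (\<lambda>m. - mcoeff f m)"

definition minus_symfun :: "'a symfun \<Rightarrow> 'a symfun \<Rightarrow> 'a symfun" where
  "minus_symfun f g = f + (- g)"

definition times_symfun :: "'a symfun \<Rightarrow> 'a symfun \<Rightarrow> 'a symfun" where
  "times_symfun f g = Abs_symfun (\<lambda>m. \<Sum>(a, b) | a + b = m. mcoeff f a * mcoeff g b)"

lemma mcoeff_add: "mcoeff (f + g :: 'a symfun) m = mcoeff f m + mcoeff g m"
proof -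
  obtain d where d: "\<And>m. mcoeff f m \<noteq> 0 \<Longrightarrow> mdeg m \<le> d" by (rule mcoeff_bounded[of f]) blast
  obtain e where e: "\<And>m. mcoeff g m \<noteq> 0 \<Longrightarrow> mdeg m \<le> e" by (rule mcoeff_bounded[of g]) blast
  have "is_symfun (\<lambda>m. mcoeff f m + mcoeff g m)"
  proof (rule is_symfunI[where d = "max d e"])
    fix m assume "mcoeff f m + mcoeff g m \<noteq> 0"
    then have "mcoeff f m \<noteq> 0 \<or> mcoeff g m \<noteq> 0" by auto
    then show "mdeg m \<le> max d e" using d[of m] e[of m] by (auto simp: le_max_iff_disj)
  qed (simp add: mcoeff_map_key)
  then show ?thesis by (simp add: plus_symfun_def mcoeff_Abs_symfun)
qed

lemma mcoeff_uminus: "mcoeff (- f :: 'a symfun) m = - mcoeff f m"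
proof -
  have "is_symfun (\<lambda>m. - mcoeff f m)"
    using is_symfun_mcoeff[of f] by (simp add: is_symfun_def)
  then show ?thesis by (simp add: uminus_symfun_def mcoeff_Abs_symfun)
qed

lemma mcoeff_mult:
  "mcoeff (f * g :: 'a symfun) m = (\<Sum>(a, b) | a + b = m. mcoeff f a * mcoeff g b)"
proof -
  obtain d where d: "\<And>m. mcoeff f m \<noteq> 0 \<Longrightarrow> mdeg m \<le> d" by (rule mcoeff_bounded[of f]) blast
  obtain e where e: "\<And>m. mcoeff g m \<noteq> 0 \<Longrightarrow> mdeg m \<le> e" by (rule mcoeff_bounded[of g]) blast
  have "is_symfun (\<lambda>m. \<Sum>(a, b) | a + b = m. mcoeff f a * mcoeff g b)"
  proof (rule is_symfunI[where d = "d + e"])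
    fix m assume "(\<Sum>(a, b) | a + b = m. mcoeff f a * mcoeff g b) \<noteq> 0"
    then obtain x where x: "x \<in> {(a, b). a + b = m}"
        "(case x of (a, b) \<Rightarrow> mcoeff f a * mcoeff g b) \<noteq> 0"
      by (rule sum.not_neutral_contains_not_neutral)
    obtain a b where [simp]: "x = (a, b)" by (cases x)
    from x have "mcoeff f a \<noteq> 0" "mcoeff g b \<noteq> 0" "m = a + b" by auto
    then show "mdeg m \<le> d + e" using d[of a] e[of b] by (simp add: mdeg_add)
  next
    fix p :: "nat \<Rightarrow> nat" and m assume p: "bij p"
    then have p': "bij (inv p)" by (rule bij_imp_bij_inv)
    show "(\<Sum>(a, b) | a + b = Poly_Mapping.map_key p m. mcoeff f a * mcoeff g b) =
        (\<Sum>(a, b) | a + b = m. mcoeff f a * mcoeff g b)"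
      by (rule sum.reindex_bij_witness[of _
            "\<lambda>(a, b). (Poly_Mapping.map_key p a, Poly_Mapping.map_key p b)"
            "\<lambda>(a, b). (Poly_Mapping.map_key (inv p) a, Poly_Mapping.map_key (inv p) b)"])
         (auto simp: map_key_inv_bij[OF p] map_key_add_bij[OF p', symmetric]
            map_key_add_bij[OF p, symmetric] mcoeff_map_key[OF p'])
  qed
  then show ?thesis by (simp add: times_symfun_def mcoeff_Abs_symfun)
qed

instance
proof
  fix a b c :: "'a symfun"
  show "a + b + c = a + (b + c)" by (rule symfun_eqI) (simp add: mcoeff_add add.assoc)
  show "a + b = b + a" by (rule symfun_eqI) (simp add: mcoeff_add add.commute)
  show "0 + a = a" by (rule symfun_eqI) (simp add: mcoeff_add)
  show "- a + a = 0" by (rule symfun_eqI) (simp add: mcoeff_add mcoeff_uminus)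
  show "a - b = a + - b" by (rule minus_symfun_def)
  show "a * b = b * a"
  proof (rule symfun_eqI, unfold mcoeff_mult)
    fix m :: monom
    show "(\<Sum>(x, y) | x + y = m. mcoeff a x * mcoeff b y) =
          (\<Sum>(x, y) | x + y = m. mcoeff b x * mcoeff a y)"
      by (rule sum.reindex_bij_witness[of _ prod.swap prod.swap]) (auto simp: ac_simps)
  qed
  show "a * b * c = a * (b * c)"
  proof (rule symfun_eqI)
    fix m :: monom
    let ?D = "\<lambda>m :: monom. {(a, b). a + b = m}"
    have "mcoeff (a * b * c) m =
        (\<Sum>x\<in>?D m. \<Sum>y\<in>?D (fst x). mcoeff a (fst y) * mcoeff b (snd y) * mcoeff c (snd x))"
      by (simp add: mcoeff_mult sum_distrib_right case_prod_beta)
    also have "\<dots> = (\<Sum>(x, y)\<in>Sigma (?D m) (\<lambda>x. ?D (fst x)).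
        mcoeff a (fst y) * mcoeff b (snd y) * mcoeff c (snd x))"
      by (rule sum.Sigma) (simp_all add: finite_add_decomps)
    also have "\<dots> = (\<Sum>(x, y)\<in>Sigma (?D m) (\<lambda>x. ?D (snd x)).
        mcoeff a (fst x) * (mcoeff b (fst y) * mcoeff c (snd y)))"
      by (rule sum.reindex_bij_witness[of _
            "\<lambda>((a, b), (c, d)). ((a + c, d), (a, c))" "\<lambda>((a, b), (c, d)). ((c, d + b), (d, b))"])
         (auto simp: ac_simps)
    also have "\<dots> = (\<Sum>x\<in>?D m. \<Sum>y\<in>?D (snd x).
        mcoeff a (fst x) * (mcoeff b (fst y) * mcoeff c (snd y)))"
      by (rule sum.Sigma[symmetric]) (simp_all add: finite_add_decomps)
    also have "\<dots> = mcoeff (a * (b * c)) m"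
      by (simp add: mcoeff_mult sum_distrib_left case_prod_beta)
    finally show "mcoeff (a * b * c) m = mcoeff (a * (b * c)) m" .
  qed
  show "1 * a = a"
  proof (rule symfun_eqI)
    fix m :: monom
    have "mcoeff (1 * a) m = (\<Sum>(x, y)\<in>{(0, m)}. mcoeff 1 x * mcoeff a y)"
      unfolding mcoeff_mult
      by (rule sum.mono_neutral_right) (auto simp: finite_add_decomps mcoeff_one split: if_splits)
    then show "mcoeff (1 * a) m = mcoeff a m"
      by (simp add: mcoeff_one)
  qed
  show "(a + b) * c = a * c + b * c"
    by (rule symfun_eqI)
       (simp add: mcoeff_mult mcoeff_add distrib_right case_prod_beta sum.distrib)
  have "mcoeff (0 :: 'a symfun) 0 \<noteq> mcoeff 1 0" by (simp add: mcoeff_one)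
  then show "(0 :: 'a symfun) \<noteq> 1" by metis
qed

end

definition symfun_smult :: "'a :: comm_ring_1 \<Rightarrow> 'a symfun \<Rightarrow> 'a symfun" where
  "symfun_smult c f = Abs_symfun (\<lambda>m. c * mcoeff f m)"

lemma mcoeff_smult: "mcoeff (symfun_smult c f) m = c * mcoeff f m"
proof -
  obtain d where d: "\<And>m. mcoeff f m \<noteq> 0 \<Longrightarrow> mdeg m \<le> d" by (rule mcoeff_bounded[of f]) blast
  have "is_symfun (\<lambda>m. c * mcoeff f m)"
    by (rule is_symfunI[where d = d]) (use d in \<open>force simp: mcoeff_map_key\<close>)+
  then show ?thesis by (simp add: symfun_smult_def mcoeff_Abs_symfun)
qed

text \<open>The canonical map $\Lambda \to \Lambda \otimes \mathbb{Q}$.\<close>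

definition symfun_rat :: "int symfun \<Rightarrow> rat symfun" where
  "symfun_rat f = Abs_symfun (\<lambda>m. of_int (mcoeff f m))"

lemma mcoeff_symfun_rat: "mcoeff (symfun_rat f) m = of_int (mcoeff f m)"
proof -
  have "is_symfun (\<lambda>m. rat_of_int (mcoeff f m))"
    using is_symfun_mcoeff[of f] by (simp add: is_symfun_def)
  then show ?thesis by (simp add: symfun_rat_def mcoeff_Abs_symfun)
qed

section \<open>Elementary, complete, monomial and forgotten symmetric functions\<close>

definition elem_sym :: "nat \<Rightarrow> 'a :: zero_neq_one symfun" where
  "elem_sym k =
     Abs_symfun (\<lambda>m. if mdeg m = k \<and> (\<forall>i. Poly_Mapping.lookup m i \<le> 1) then 1 else 0)"

lemma mcoeff_elem_sym:
  "mcoeff (elem_sym k) m =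
     (if mdeg m = k \<and> (\<forall>i. Poly_Mapping.lookup m i \<le> 1) then 1 else 0 :: 'a :: zero_neq_one)"
proof -
  have *: "(\<forall>i. Poly_Mapping.lookup m (p i) \<le> 1) \<longleftrightarrow> (\<forall>i. Poly_Mapping.lookup m i \<le> 1)"
    if "bij p" for p and m :: monom
    using that by (metis bij_pointE)
  have "is_symfun
      (\<lambda>m. if mdeg m = k \<and> (\<forall>i. Poly_Mapping.lookup m i \<le> 1) then 1 else 0 :: 'a)"
    by (rule is_symfunI[where d = k])
       (simp_all only: mdeg_map_key lookup_map_key_bij *, auto split: if_splits)
  then show ?thesis by (simp add: elem_sym_def mcoeff_Abs_symfun)
qed

definition complete_sym :: "nat \<Rightarrow> 'a :: zero_neq_one symfun" where
  "complete_sym k = Abs_symfun (\<lambda>m. if mdeg m = k then 1 else 0)"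

lemma mcoeff_complete_sym:
  "mcoeff (complete_sym k) m = (if mdeg m = k then 1 else 0 :: 'a :: zero_neq_one)"
proof -
  have "is_symfun (\<lambda>m. if mdeg m = k then 1 else 0 :: 'a)"
    by (rule is_symfunI[where d = k]) (auto simp: mdeg_map_key split: if_splits)
  then show ?thesis by (simp add: complete_sym_def mcoeff_Abs_symfun)
qed

definition exponents :: "monom \<Rightarrow> nat multiset" where
  "exponents m = image_mset (Poly_Mapping.lookup m) (mset_set (Poly_Mapping.keys m))"

lemma exponents_map_key: "bij p \<Longrightarrow> exponents (Poly_Mapping.map_key p m) = exponents m"
proof -
  assume p: "bij p"
  have "exponents (Poly_Mapping.map_key p m) =
      image_mset (Poly_Mapping.lookup m)
        (image_mset p (mset_set (Poly_Mapping.keys (Poly_Mapping.map_key p m))))"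
    unfolding exponents_def multiset.map_comp
    by (rule image_mset_cong) (simp add: lookup_map_key_bij[OF p])
  also have "image_mset p (mset_set (Poly_Mapping.keys (Poly_Mapping.map_key p m))) =
      mset_set (Poly_Mapping.keys m)"
    using bij_betw_keys_map_key[OF p, of m] by (simp add: bij_betw_def image_mset_mset_set)
  finally show ?thesis by (simp add: exponents_def)
qed

lemma sum_mset_exponents: "sum_mset (exponents m) = mdeg m"
  by (simp add: exponents_def mdeg_def sum_unfold_sum_mset)

definition partitions :: "nat \<Rightarrow> nat list set" where
  "partitions k = {l. sorted_wrt (\<ge>) l \<and> (\<forall>i\<in>set l. i > 0) \<and> sum_list l = k}"

definition monomial_sym :: "nat list \<Rightarrow> 'a :: zero_neq_one symfun" where
  "monomial_sym l = Abs_symfun (\<lambda>m. if exponents m = mset l then 1 else 0)"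

lemma mcoeff_monomial_sym:
  "mcoeff (monomial_sym l) m = (if exponents m = mset l then 1 else 0 :: 'a :: zero_neq_one)"
proof -
  have *: "mdeg m = sum_list l" if "exponents m = mset l" for m
    using that sum_mset_exponents[of m] by (simp add: sum_mset_sum_list)
  have "is_symfun (\<lambda>m. if exponents m = mset l then 1 else 0 :: 'a)"
    by (rule is_symfunI[where d = "sum_list l"])
       (auto simp: exponents_map_key * split: if_splits)
  then show ?thesis by (simp add: monomial_sym_def mcoeff_Abs_symfun)
qed

text \<open>
  The $e_k$ generate $\Lambda$ as a ring, so the following ring endomorphism is unique; that it is
  an involution is a consequence.
\<close>

definition omega :: "int symfun \<Rightarrow> int symfun" where
  "omega = (THE w. w 1 = 1 \<and> (\<forall>f g. w (f + g) = w f + w g) \<and> (\<forall>f g. w (f * g) = w f * w g) \<and>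
                   (\<forall>k. w (elem_sym k) = complete_sym k))"

definition forgotten_sym :: "nat list \<Rightarrow> int symfun" where
  "forgotten_sym l = omega (monomial_sym l)"

section \<open>Todd polynomials and Todd symmetric functions\<close>

text \<open>Polynomials in $x_1, x_2, \dots$ over $\mathbb{Q}$.\<close>

type_synonym rpoly = "monom \<Rightarrow>\<^sub>0 rat"

definition todd_series :: "rat fps" where
  "todd_series = fps_X / (1 - fps_exp (-1))"

text \<open>The power series $t x / (1 - e^{-t x})$ in $t$, for $x$ the variable with index \<open>i\<close>.\<close>

definition todd_factor :: "nat \<Rightarrow> rpoly fps" where
  "todd_factor i = Abs_fps (\<lambda>j. Poly_Mapping.single (Poly_Mapping.single i j) (fps_nth todd_series j))"

text \<open>
  \<open>todd_poly n k\<close> is the value $T_k(c_1, \dots, c_n)$ at $c_j = e_j(x_1, \dots, x_n)$, as a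
  polynomial in the $x_i$.
\<close>

definition todd_poly :: "nat \<Rightarrow> nat \<Rightarrow> rpoly" where
  "todd_poly n k = fps_nth (\<Prod>i<n. todd_factor i) k"

text \<open>The specialisation $x_i = 0$ for all $i > n$.\<close>

definition restrict_vars :: "nat \<Rightarrow> rat symfun \<Rightarrow> rpoly" where
  "restrict_vars n f =
     Abs_poly_mapping (\<lambda>m. if Poly_Mapping.keys m \<subseteq> {..<n} then mcoeff f m else 0)"

lemma lookup_restrict_vars:
  "Poly_Mapping.lookup (restrict_vars n f) m =
     (if Poly_Mapping.keys m \<subseteq> {..<n} then mcoeff f m else 0)"
proof -
  obtain d where "\<And>m. mcoeff f m \<noteq> 0 \<Longrightarrow> mdeg m \<le> d" by (rule mcoeff_bounded[of f]) blast
  then have "{m. (if Poly_Mapping.keys m \<subseteq> {..<n} then mcoeff f m else 0) \<noteq> 0} \<subseteq>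
      {m. Poly_Mapping.keys m \<subseteq> {..<n} \<and> mdeg m \<le> d}"
    by auto
  then have "finite {m. (if Poly_Mapping.keys m \<subseteq> {..<n} then mcoeff f m else 0) \<noteq> 0}"
    by (rule finite_subset) (simp add: finite_monoms_bounded)
  then show ?thesis by (simp add: restrict_vars_def)
qed

definition homogeneous :: "nat \<Rightarrow> 'a :: zero symfun \<Rightarrow> bool" where
  "homogeneous k f \<longleftrightarrow> (\<forall>m. mcoeff f m \<noteq> 0 \<longrightarrow> mdeg m = k)"

definition todd_sym :: "nat \<Rightarrow> rat symfun" where
  "todd_sym k = (THE f. homogeneous k f \<and> restrict_vars k f = todd_poly k k)"

end

theory Submission
  imports Defs "HOL-Combinatorics.Permutations"
begin

text \<open>
  Let $F(t) = 1 + \dots$ be a power series over $\mathbb{Q}$ and let $M_k(F)$ (\<open>mult_sym F k\<close>)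
  be the part of degree $k$ of $\prod_i F(x_i)$; its coefficient at $m_\lambda$ is $\prod_i F_{\lambda_i}$.  By definition
  $T_k = M_k(G)$ with $G(t) = t / (1 - e^{-t})$ (\<open>todd_sym_eq_mult_sym\<close>), and
  $\sum_{|\lambda| = k} m_\lambda / \prod_i (\lambda_i + 1)! = M_k(F)$ with $F(t) = (e^t - 1) / t$
  (\<open>mult_sym_eq_sum_monomial_sym\<close>).  As $F(t) G(-t) = 1$, the theorem is the case
  $F(t) = (e^t - 1) / t$ of the rule $\omega(M_k(F)) = M_k(1 / F(-t))$, which for $F(t) = 1 + t$ is
  $\omega(e_k) = h_k$.

  The rule comes from a description of $\omega$ that makes no reference to generators.  Substitute
  into $f \in \Lambda$ the variables $x_1, \dots, x_n$, each repeated $N$ times.  For every $N$ this is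
  a ring homomorphism in $f$, the result depends polynomially on $N$, and its value at $N = -1$ is
  $(\omega f)(-x_1, \dots, -x_n)$.  Indeed $M_k(F)$ goes to the coefficient of $t^k$ in
  $\prod_i F(x_i t)^N$, which is polynomial in $N$ and at $N = -1$ equals the coefficient in
  $\prod_i F(x_i t)^{-1}$.  So \<open>omega_related f g\<close>, saying that $g(-x)$ extends the sequence of
  these substitutions in $f$ polynomially to $N = -1$, is compatible with sums, products and scalars,
  determines $g$ (\<open>omega_related_unique\<close>), and holds between $M_k(F)$ and $M_k(1/F(-t))$ for all $F$
  (\<open>omega_related_mult_sym\<close>).

  It remains to see that this is the graph of $\omega$.  The $e_k$ generate $\Lambda$
  (\<open>elem_sym_generate\<close>), and $e_k$ is related to $h_k$; hence every $f \in \Lambda$ is related to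
  some, and then exactly one, $g \in \Lambda$, and $f \mapsto g$ is the only ring endomorphism with
  $e_k \mapsto h_k$ (\<open>omega_related_omega\<close>).
\<close>

section \<open>Polynomial sequences\<close>

text \<open>
  Sequences with a vanishing iterated difference: the sequences polynomial in the index, in a form
  that makes sense without denominators and is suited to induction on the degree.
\<close>

inductive polyseq :: "(nat \<Rightarrow> 'a :: comm_ring_1) \<Rightarrow> bool" where
  zero: "polyseq (\<lambda>_. 0)"
| step: "polyseq (\<lambda>N. g (Suc N) - g N) \<Longrightarrow> polyseq g"

lemma polyseq_const: "polyseq (\<lambda>_. c)"
  by (rule polyseq.step) (simp add: polyseq.zero)

lemma polyseq_add: "polyseq f \<Longrightarrow> polyseq g \<Longrightarrow> polyseq (\<lambda>N. f N + g N)"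
proof (induction arbitrary: g rule: polyseq.induct)
  case zero
  then show ?case by simp
next
  case (step f)
  have "polyseq (\<lambda>N. g (Suc N) - g N)" using step.prems
  proof cases
    case zero
    then show ?thesis by (simp add: polyseq.zero)
  next
    case step
    then show ?thesis by simp
  qed
  from step.IH[OF this] show ?case
    by - (rule polyseq.step, simp add: algebra_simps)
qed

lemma polyseq_shift: "polyseq f \<Longrightarrow> polyseq (\<lambda>N. f (Suc N))"
proof (induction rule: polyseq.induct)
  case zero
  show ?case by (rule polyseq.zero)
next
  case (step f)
  show ?case by (rule polyseq.step) (rule step.IH)
qed

lemma polyseq_mult: "polyseq f \<Longrightarrow> polyseq g \<Longrightarrow> polyseq (\<lambda>N. f N * g N)"
proof (induction arbitrary: g rule: polyseq.induct)
  case zero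
  then show ?case by (simp add: polyseq.zero)
next
  case (step f)
  note f_IH = step.IH and f = step.hyps
  from \<open>polyseq g\<close> show ?case
  proof (induction rule: polyseq.induct)
    case zero
    then show ?case by (simp add: polyseq.zero)
  next
    case (step g)
    have g: "polyseq g" by (rule polyseq.step) (rule step.hyps)
    \<comment> \<open>The discrete Leibniz rule: \<open>\<Delta>(f g) = \<Delta>f (shifted g) + f \<Delta>g\<close>.\<close>
    have "polyseq (\<lambda>N. (f (Suc N) - f N) * g (Suc N) + f N * (g (Suc N) - g N))"
      by (intro polyseq_add f_IH polyseq_shift g step.IH)
    then show ?case
      by - (rule polyseq.step, simp add: algebra_simps)
  qed
qed

text \<open>
  A polynomial sequence is determined by its values from the second on.  With the index shifted by
  one, this says that the extension of a polynomial sequence to the argument $-1$ is unique.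
\<close>

lemma polyseq_eq_zero: "polyseq g \<Longrightarrow> (\<And>N. g (Suc N) = 0) \<Longrightarrow> g N = 0"
proof (induction arbitrary: N rule: polyseq.induct)
  case (step g)
  have "g (Suc 0) - g 0 = 0" by (rule step.IH) (simp add: step.prems)
  then show ?case using step.prems by (cases N) auto
qed simp

text \<open>
  With $A = 1 + t C$, the difference of $[t^{k+1}] B A^N$ in $N$ is $[t^k] (B C) A^N$, so the degree in
  $N$ is at most $k$.  For $B = A^{-1}$ the sequence starts with the value at exponent $-1$.
\<close>

lemma polyseq_fps_nth_power:
  fixes A B :: "'a :: comm_ring_1 fps"
  assumes "fps_nth A 0 = 1"
  shows "polyseq (\<lambda>N. fps_nth (B * A ^ N) k)"
proof (induction k arbitrary: B)
  case 0
  have "fps_nth (A ^ N) 0 = 1" for N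
    by (induction N) (simp_all add: assms)
  then show ?case by (simp add: polyseq_const)
next
  case (Suc k)
  define C where "C = fps_shift 1 (A - 1)"
  have C: "A = 1 + fps_X * C"
  proof (rule fps_ext)
    fix j show "fps_nth A j = fps_nth (1 + fps_X * C) j"
      by (cases j) (simp_all add: C_def assms)
  qed
  have "B * A ^ Suc N - B * A ^ N = fps_X * ((B * C) * A ^ N)" for N
  proof -
    have "B * A ^ Suc N - B * A ^ N = B * (A - 1) * A ^ N" by (simp add: algebra_simps)
    also have "A - 1 = fps_X * C" by (subst C) simp
    finally show ?thesis by (simp add: mult_ac)
  qed
  then have "fps_nth (B * A ^ Suc N) (Suc k) - fps_nth (B * A ^ N) (Suc k) =
      fps_nth ((B * C) * A ^ N) k" for N
    by (metis fps_sub_nth fps_X_mult_nth Suc_neq_Zero diff_Suc_1)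
  then show ?case
    by - (rule polyseq.step, simp only: Suc.IH)
qed

section \<open>Substitution of polynomials into symmetric functions\<close>

lemma keys_add_monom: "Poly_Mapping.keys (a + b :: monom) = Poly_Mapping.keys a \<union> Poly_Mapping.keys b"
  by (auto simp: in_keys_iff lookup_add)

lemma mcoeff_mult_nonzero:
  assumes "mcoeff (f * g) m \<noteq> 0"
  obtains a b where "a + b = m" "mcoeff f a \<noteq> 0" "mcoeff g b \<noteq> 0"
proof -
  have "(\<Sum>(a, b) | a + b = m. mcoeff f a * mcoeff g b) \<noteq> 0"
    using assms by (simp add: mcoeff_mult)
  then obtain x where "x \<in> {(a, b). a + b = m}"
      "(case x of (a, b) \<Rightarrow> mcoeff f a * mcoeff g b) \<noteq> 0"
    by (rule sum.not_neutral_contains_not_neutral)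
  then show ?thesis by (intro that[of "fst x" "snd x"]) auto
qed

lemma single_sum:
  "Poly_Mapping.single a (\<Sum>x\<in>S. c x) = (\<Sum>x\<in>S. Poly_Mapping.single a (c x :: 'b :: comm_monoid_add))"
  by (induction S rule: infinite_finite_induct) (simp_all add: single_add)

lemma single_zero_prod:
  "Poly_Mapping.single (0 :: monom) (\<Prod>i\<in>S. c i :: rat) = (\<Prod>i\<in>S. Poly_Mapping.single 0 (c i))"
  by (induction S rule: infinite_finite_induct)
     (simp_all add: mult_single[of 0 _ 0, simplified, symmetric])

text \<open>
  The value $f(v_1, \dots, v_n)$ at polynomials $v_i$.  Only the monomials in the first $n$ variables
  contribute, and as $f$ has bounded degree these are finitely many.
\<close>

definition eval_sym :: "nat \<Rightarrow> (nat \<Rightarrow> rpoly) \<Rightarrow> rat symfun \<Rightarrow> rpoly" where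
  "eval_sym n v f = (\<Sum>m | Poly_Mapping.keys m \<subseteq> {..<n} \<and> mcoeff f m \<noteq> 0.
     Poly_Mapping.single 0 (mcoeff f m) * (\<Prod>i<n. v i ^ Poly_Mapping.lookup m i))"

definition monoms_upto :: "nat \<Rightarrow> nat \<Rightarrow> monom set" where
  "monoms_upto n d = {m. Poly_Mapping.keys m \<subseteq> {..<n} \<and> mdeg m \<le> d}"

lemma finite_monoms_upto [simp]: "finite (monoms_upto n d)"
  unfolding monoms_upto_def by (rule finite_monoms_bounded) simp

lemma eval_sym_upto:
  assumes "\<forall>m. mcoeff f m \<noteq> 0 \<longrightarrow> mdeg m \<le> d"
  shows "eval_sym n v f = (\<Sum>m\<in>monoms_upto n d.
     Poly_Mapping.single 0 (mcoeff f m) * (\<Prod>i<n. v i ^ Poly_Mapping.lookup m i))"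
  unfolding eval_sym_def
  by (rule sum.mono_neutral_left)
     (auto simp: monoms_upto_def[symmetric], auto simp: monoms_upto_def assms)

lemma eval_sym_add: "eval_sym n v (f + g) = eval_sym n v f + eval_sym n v g"
proof -
  obtain d where d: "\<forall>m. mcoeff f m \<noteq> 0 \<longrightarrow> mdeg m \<le> d"
    by (rule mcoeff_bounded[of f]) blast
  obtain e where e: "\<forall>m. mcoeff g m \<noteq> 0 \<longrightarrow> mdeg m \<le> e"
    by (rule mcoeff_bounded[of g]) blast
  have fg: "\<forall>m. mcoeff (f + g) m \<noteq> 0 \<longrightarrow> mdeg m \<le> max d e"
    "\<forall>m. mcoeff f m \<noteq> 0 \<longrightarrow> mdeg m \<le> max d e" "\<forall>m. mcoeff g m \<noteq> 0 \<longrightarrow> mdeg m \<le> max d e"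
    using d e by (auto simp only: mcoeff_add le_max_iff_disj) (metis add_0)
  show ?thesis
    unfolding eval_sym_upto[OF fg(1)] eval_sym_upto[OF fg(2)] eval_sym_upto[OF fg(3)]
    by (simp add: mcoeff_add single_add distrib_right sum.distrib)
qed

lemma eval_sym_mult: "eval_sym n v (f * g) = eval_sym n v f * eval_sym n v g"
proof -
  obtain d where d: "\<forall>m. mcoeff f m \<noteq> 0 \<longrightarrow> mdeg m \<le> d"
    by (rule mcoeff_bounded[of f]) blast
  obtain e where e: "\<forall>m. mcoeff g m \<noteq> 0 \<longrightarrow> mdeg m \<le> e"
    by (rule mcoeff_bounded[of g]) blast
  have fg: "\<forall>m. mcoeff (f * g) m \<noteq> 0 \<longrightarrow> mdeg m \<le> d + e"
  proof (intro allI impI)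
    fix m assume "mcoeff (f * g) m \<noteq> 0"
    then obtain a b where ab: "a + b = m" "mcoeff f a \<noteq> 0" "mcoeff g b \<noteq> 0"
      by (rule mcoeff_mult_nonzero)
    then have "mdeg a \<le> d" "mdeg b \<le> e" using d e by auto
    then show "mdeg m \<le> d + e" using ab(1) by (auto simp: mdeg_add)
  qed
  let ?v = "\<lambda>m. \<Prod>i<n. v i ^ Poly_Mapping.lookup m i"
  let ?t = "\<lambda>h m. Poly_Mapping.single 0 (mcoeff h m) * ?v m"
  let ?D = "\<lambda>m :: monom. {(a, b). a + b = m}"
  have pair: "Poly_Mapping.single 0 (mcoeff f a * mcoeff g b) * ?v (a + b) = ?t f a * ?t g b" for a b
    by (simp add: lookup_add power_add prod.distrib mult_ac
        mult_single[of 0 _ 0, simplified, symmetric])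
  have "eval_sym n v (f * g) = (\<Sum>m\<in>monoms_upto n (d + e). ?t (f * g) m)"
    by (rule eval_sym_upto[OF fg])
  also have "\<dots> = (\<Sum>m\<in>monoms_upto n (d + e). \<Sum>x\<in>?D m. ?t f (fst x) * ?t g (snd x))"
  proof (rule sum.cong[OF refl])
    fix m
    have "?t (f * g) m =
        (\<Sum>x\<in>?D m. Poly_Mapping.single 0 (mcoeff f (fst x) * mcoeff g (snd x)) * ?v m)"
      by (simp add: mcoeff_mult single_sum sum_distrib_right case_prod_beta)
    also have "\<dots> = (\<Sum>x\<in>?D m. ?t f (fst x) * ?t g (snd x))"
      by (rule sum.cong[OF refl]) (use pair in auto)
    finally show "?t (f * g) m = (\<Sum>x\<in>?D m. ?t f (fst x) * ?t g (snd x))" .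
  qed
  also have "\<dots> = (\<Sum>(m, x)\<in>Sigma (monoms_upto n (d + e)) ?D. ?t f (fst x) * ?t g (snd x))"
    by (rule sum.Sigma) (simp_all add: finite_add_decomps)
  \<comment> \<open>A pair of monomials beyond the degree bounds of \<open>f\<close> and \<open>g\<close> can have a product of degree at most
    \<open>d + e\<close>, but then one of the coefficients vanishes.\<close>
  also have "\<dots> = (\<Sum>(m, x)\<in>{(m, x). x \<in> monoms_upto n d \<times> monoms_upto n e \<and> m = fst x + snd x}.
      ?t f (fst x) * ?t g (snd x))"
  proof (rule sum.mono_neutral_right)
    show "finite (Sigma (monoms_upto n (d + e)) ?D)"
      by (auto simp: finite_add_decomps)
    show "{(m, x). x \<in> monoms_upto n d \<times> monoms_upto n e \<and> m = fst x + snd x}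
        \<subseteq> Sigma (monoms_upto n (d + e)) ?D"
      by (auto simp: monoms_upto_def mdeg_add keys_add_monom)
    show "\<forall>y\<in>Sigma (monoms_upto n (d + e)) ?D -
        {(m, x). x \<in> monoms_upto n d \<times> monoms_upto n e \<and> m = fst x + snd x}.
        (case y of (m, x) \<Rightarrow> ?t f (fst x) * ?t g (snd x)) = 0"
    proof
      fix y assume y: "y \<in> Sigma (monoms_upto n (d + e)) ?D -
        {(m, x). x \<in> monoms_upto n d \<times> monoms_upto n e \<and> m = fst x + snd x}"
      obtain a b where [simp]: "y = (a + b, (a, b))" using y by auto
      from y have "\<not> (mdeg a \<le> d \<and> mdeg b \<le> e)"
        by (auto simp: monoms_upto_def keys_add_monom)
      then have "mcoeff f a = 0 \<or> mcoeff g b = 0" using d e by blast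
      then show "(case y of (m, x) \<Rightarrow> ?t f (fst x) * ?t g (snd x)) = 0" by auto
    qed
  qed
  also have "\<dots> = (\<Sum>x\<in>monoms_upto n d \<times> monoms_upto n e. ?t f (fst x) * ?t g (snd x))"
    by (rule sum.reindex_bij_witness[of _ "\<lambda>x. (fst x + snd x, x)" snd]) auto
  also have "\<dots> = (\<Sum>a\<in>monoms_upto n d. ?t f a) * (\<Sum>b\<in>monoms_upto n e. ?t g b)"
    by (simp add: sum_product sum.cartesian_product case_prod_beta)
  also have "\<dots> = eval_sym n v f * eval_sym n v g"
    by (simp only: eval_sym_upto[OF d] eval_sym_upto[OF e])
  finally show ?thesis .
qed

lemma eval_sym_smult: "eval_sym n v (symfun_smult c f) = Poly_Mapping.single 0 c * eval_sym n v f"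
proof -
  obtain d where d: "\<forall>m. mcoeff f m \<noteq> 0 \<longrightarrow> mdeg m \<le> d"
    by (rule mcoeff_bounded[of f]) blast
  have d': "\<forall>m. mcoeff (symfun_smult c f) m \<noteq> 0 \<longrightarrow> mdeg m \<le> d"
    using d by (auto simp: mcoeff_smult)
  show ?thesis
    unfolding eval_sym_upto[OF d] eval_sym_upto[OF d']
    by (simp add: mcoeff_smult sum_distrib_left mult.assoc[symmetric] mult_single)
qed

section \<open>Symmetric functions with product generating function\<close>

text \<open>The series $F(w t)$ in $t$.\<close>

definition scaled_series :: "rat fps \<Rightarrow> rpoly \<Rightarrow> rpoly fps" where
  "scaled_series F w = Abs_fps (\<lambda>j. Poly_Mapping.single 0 (fps_nth F j) * w ^ j)"

text \<open>
  For $F(0) = 1$ this is the part of degree $k$ of $\prod_i F(x_i)$; the condition $F(0) = 1$ lets the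
  product over all variables run over those that occur in the monomial.
\<close>

definition mult_sym :: "'a :: comm_ring_1 fps \<Rightarrow> nat \<Rightarrow> 'a symfun" where
  "mult_sym F k = Abs_symfun (\<lambda>m. if mdeg m = k
     then \<Prod>i\<in>Poly_Mapping.keys m. fps_nth F (Poly_Mapping.lookup m i) else 0)"

lemma mcoeff_mult_sym:
  "mcoeff (mult_sym F k) m =
     (if mdeg m = k then \<Prod>i\<in>Poly_Mapping.keys m. fps_nth F (Poly_Mapping.lookup m i) else 0)"
proof -
  have *: "(\<Prod>i\<in>Poly_Mapping.keys (Poly_Mapping.map_key p m).
        fps_nth F (Poly_Mapping.lookup (Poly_Mapping.map_key p m) i)) =
      (\<Prod>i\<in>Poly_Mapping.keys m. fps_nth F (Poly_Mapping.lookup m i))" if "bij p" for p m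
    by (simp add: lookup_map_key_bij[OF that])
       (rule prod.reindex_bij_betw[OF bij_betw_keys_map_key[OF that]])
  have "is_symfun (\<lambda>m. if mdeg m = k
     then \<Prod>i\<in>Poly_Mapping.keys m. fps_nth F (Poly_Mapping.lookup m i) else 0)"
    by (rule is_symfunI[where d = k]) (simp_all only: mdeg_map_key *, auto split: if_splits)
  then show ?thesis by (simp add: mult_sym_def mcoeff_Abs_symfun)
qed

lemma eval_sym_mult_sym:
  assumes "fps_nth F 0 = 1"
  shows "eval_sym n v (mult_sym F k) = fps_nth (\<Prod>i<n. scaled_series F (v i)) k"
proof -
  let ?S = "{m :: monom. Poly_Mapping.keys m \<subseteq> {..<n} \<and> mdeg m = k}"
  let ?f = "\<lambda>m. Poly_Mapping.single 0 (mcoeff (mult_sym F k) m) *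
    (\<Prod>i<n. v i ^ Poly_Mapping.lookup m i)"
  let ?g = "\<lambda>c. \<Prod>i<n. fps_nth (scaled_series F (v i)) (c i)"
  have "eval_sym n v (mult_sym F k) = (\<Sum>m\<in>monoms_upto n k. ?f m)"
    by (rule eval_sym_upto) (auto simp: mcoeff_mult_sym split: if_splits)
  also have "\<dots> = (\<Sum>m\<in>?S. ?f m)"
  proof (rule sum.mono_neutral_right)
    show "\<forall>m\<in>monoms_upto n k - ?S. ?f m = 0"
      by (simp add: monoms_upto_def mcoeff_mult_sym)
    show "?S \<subseteq> monoms_upto n k" unfolding monoms_upto_def by blast
  qed simp
  also have "\<dots> = (\<Sum>m\<in>?S. ?g (Poly_Mapping.lookup m))"
  proof (rule sum.cong[OF refl])
    fix m assume m: "m \<in> ?S"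
    then have "mcoeff (mult_sym F k) m =
        (\<Prod>i\<in>Poly_Mapping.keys m. fps_nth F (Poly_Mapping.lookup m i))"
      by (simp add: mcoeff_mult_sym)
    also have "\<dots> = (\<Prod>i<n. fps_nth F (Poly_Mapping.lookup m i))"
      by (rule prod.mono_neutral_left) (use m in \<open>auto simp: in_keys_iff assms\<close>)
    finally have c: "mcoeff (mult_sym F k) m = (\<Prod>i<n. fps_nth F (Poly_Mapping.lookup m i))" .
    show "?f m = ?g (Poly_Mapping.lookup m)"
      unfolding c single_zero_prod scaled_series_def fps_nth_Abs_fps by (rule prod.distrib[symmetric])
  qed
  \<comment> \<open>The coefficients of a product of series are sums over multisets of indices, which are the
    monomials, read as multisets of variables.\<close>
  also have "\<dots> = (\<Sum>X\<in>multisets_of_size {..<n} k. ?g (count X))"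
  proof (rule sum.reindex_bij_witness[of _ "\<lambda>X. Abs_poly_mapping (count X)"
        "\<lambda>m. Abs_multiset (Poly_Mapping.lookup m)"])
    fix m assume m: "m \<in> ?S"
    have c: "count (Abs_multiset (Poly_Mapping.lookup m)) = Poly_Mapping.lookup m"
      using finite_lookup[of m] by (intro Abs_multiset_inverse) (simp del: finite_lookup)
    then show "Abs_poly_mapping (count (Abs_multiset (Poly_Mapping.lookup m))) = m"
      by (simp add: lookup_inverse)
    have s: "set_mset (Abs_multiset (Poly_Mapping.lookup m)) = Poly_Mapping.keys m"
      unfolding set_mset_def c by (auto simp: in_keys_iff)
    have "size (Abs_multiset (Poly_Mapping.lookup m)) = mdeg m"
      unfolding size_multiset_overloaded_eq s c mdeg_def ..
    then show "Abs_multiset (Poly_Mapping.lookup m) \<in> multisets_of_size {..<n} k"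
      using m unfolding multisets_of_size_def by (simp only: s mem_Collect_eq)
    show "?g (count (Abs_multiset (Poly_Mapping.lookup m))) = ?g (Poly_Mapping.lookup m)"
      by (simp only: c)
  next
    fix X assume X: "X \<in> multisets_of_size {..<n} k"
    have "finite {i. count X i \<noteq> 0}"
      by (rule finite_subset[OF _ finite_set_mset[of X]]) (auto simp: count_eq_zero_iff)
    then have l: "Poly_Mapping.lookup (Abs_poly_mapping (count X)) = count X"
      by (rule lookup_Abs_poly_mapping)
    then show "Abs_multiset (Poly_Mapping.lookup (Abs_poly_mapping (count X))) = X"
      by (simp only: count_inverse)
    have s: "Poly_Mapping.keys (Abs_poly_mapping (count X)) = set_mset X"
      by (rule set_eqI) (simp only: in_keys_iff l count_eq_zero_iff not_not)
    have "mdeg (Abs_poly_mapping (count X)) = size X"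
      unfolding size_multiset_overloaded_eq s l mdeg_def ..
    then show "Abs_poly_mapping (count X) \<in> ?S"
      using X unfolding multisets_of_size_def by (simp only: s mem_Collect_eq)
  qed
  also have "\<dots> = fps_nth (\<Prod>i<n. scaled_series F (v i)) k"
    by (rule fps_prod_nth'[symmetric]) simp
  finally show ?thesis .
qed

definition signed_var :: "rat \<Rightarrow> nat \<Rightarrow> rpoly" where
  "signed_var s i = Poly_Mapping.single (Poly_Mapping.single i 1) s"

lemma single_power:
  "Poly_Mapping.single (Poly_Mapping.single i (1 :: nat)) (c :: rat) ^ j =
     Poly_Mapping.single (Poly_Mapping.single i j) (c ^ j)"
  by (induction j) (simp_all add: mult_single single_add[symmetric])

lemma prod_signed_var:
  assumes "Poly_Mapping.keys m \<subseteq> {..<n}"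
  shows "(\<Prod>i<n. signed_var s i ^ Poly_Mapping.lookup m i) = Poly_Mapping.single m (s ^ mdeg m)"
proof -
  have *: "(\<Prod>i\<in>A. Poly_Mapping.single (a i) (c i)) = Poly_Mapping.single (\<Sum>i\<in>A. a i) (\<Prod>i\<in>A. c i)"
    for A :: "nat set" and a :: "nat \<Rightarrow> monom" and c :: "nat \<Rightarrow> rat"
    by (induction A rule: infinite_finite_induct) (simp_all add: mult_single)
  have "(\<Sum>i<n. Poly_Mapping.single i (Poly_Mapping.lookup m i)) = m"
    by (rule poly_mapping_eqI) (use assms in \<open>auto simp: lookup_sum lookup_single when_def in_keys_iff\<close>)
  moreover have "(\<Prod>i<n. s ^ Poly_Mapping.lookup m i) = s ^ mdeg m"
    using mdeg_superset[OF _ assms] by (simp add: power_sum)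
  ultimately show ?thesis
    unfolding signed_var_def single_power by (simp add: *)
qed

lemma lookup_eval_sym_signed_var:
  "Poly_Mapping.lookup (eval_sym n (signed_var s) f) m =
     (if Poly_Mapping.keys m \<subseteq> {..<n} then s ^ mdeg m * mcoeff f m else 0)"
proof -
  obtain d where d: "\<forall>m. mcoeff f m \<noteq> 0 \<longrightarrow> mdeg m \<le> d"
    by (rule mcoeff_bounded[of f]) blast
  have "eval_sym n (signed_var s) f =
      (\<Sum>a\<in>monoms_upto n d. Poly_Mapping.single a (s ^ mdeg a * mcoeff f a))"
    unfolding eval_sym_upto[OF d]
    by (rule sum.cong[OF refl])
       (subst prod_signed_var, auto simp: monoms_upto_def mult_single mult.commute)
  then have "Poly_Mapping.lookup (eval_sym n (signed_var s) f) m =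
      (\<Sum>a\<in>monoms_upto n d. if a = m then s ^ mdeg m * mcoeff f m else 0)"
    by (auto simp: lookup_sum lookup_single when_def intro!: sum.cong)
  also have "\<dots> = (if m \<in> monoms_upto n d then s ^ mdeg m * mcoeff f m else 0)"
    by simp
  finally show ?thesis using d by (auto simp: monoms_upto_def)
qed

lemma restrict_vars_eq_eval_sym: "restrict_vars n f = eval_sym n (signed_var 1) f"
  by (rule poly_mapping_eqI) (simp add: lookup_restrict_vars lookup_eval_sym_signed_var)

lemma scaled_series_mult: "scaled_series (F * G) w = scaled_series F w * scaled_series G w"
proof (rule fps_ext)
  fix k
  have "fps_nth (scaled_series (F * G) w) k =
      (\<Sum>i=0..k. Poly_Mapping.single 0 (fps_nth F i * fps_nth G (k - i)) * w ^ k)"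
    by (simp add: scaled_series_def fps_mult_nth single_sum sum_distrib_right)
  also have "\<dots> = (\<Sum>i=0..k. fps_nth (scaled_series F w) i * fps_nth (scaled_series G w) (k - i))"
  proof (rule sum.cong[OF refl])
    fix i assume "i \<in> {0..k}"
    then have w: "w ^ k = w ^ i * w ^ (k - i)" by (simp add: power_add[symmetric])
    have "Poly_Mapping.single 0 (fps_nth F i * fps_nth G (k - i)) =
        Poly_Mapping.single (0::monom) (fps_nth F i) * Poly_Mapping.single 0 (fps_nth G (k - i))"
      by (simp add: mult_single)
    then show "Poly_Mapping.single 0 (fps_nth F i * fps_nth G (k - i)) * w ^ k =
        fps_nth (scaled_series F w) i * fps_nth (scaled_series G w) (k - i)"
      unfolding w by (simp add: scaled_series_def mult_ac)
  qed
  finally show "fps_nth (scaled_series (F * G) w) k = fps_nth (scaled_series F w * scaled_series G w) k"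
    by (simp add: fps_mult_nth)
qed

lemma scaled_series_one: "scaled_series 1 w = 1"
  by (rule fps_ext) (simp add: scaled_series_def)

lemma scaled_series_neg_var:
  "scaled_series G (signed_var (- 1) i) = scaled_series (G oo - fps_X) (signed_var 1 i)"
proof (rule fps_ext)
  fix j
  show "fps_nth (scaled_series G (signed_var (- 1) i)) j =
      fps_nth (scaled_series (G oo - fps_X) (signed_var 1 i)) j"
    by (simp add: scaled_series_def fps_compose_uminus' signed_var_def single_power[simplified]
        mult_single mult.commute)
qed

section \<open>The involution as extension to multiplicity minus one\<close>

text \<open>
  The entry of index $0$ is the value at multiplicity $-1$ and the entry of index $N + 1$ the value at
  multiplicity $N$: the variables with index \<open>j < n * N\<close> run through $x_1, \dots, x_n$ cyclically, so
  that each is repeated $N$ times.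
\<close>

definition omega_related :: "rat symfun \<Rightarrow> rat symfun \<Rightarrow> bool" where
  "omega_related f g \<longleftrightarrow> (\<forall>n. polyseq (case_nat (eval_sym n (signed_var (- 1)) g)
     (\<lambda>N. eval_sym (n * N) (\<lambda>j. signed_var 1 (j mod n)) f)))"

lemma polyseq_case_nat_op:
  assumes "polyseq (case_nat a f)" "polyseq (case_nat b g)"
  shows "polyseq (case_nat (a + b) (\<lambda>N. f N + g N))" "polyseq (case_nat (a * b) (\<lambda>N. f N * g N))"
proof -
  have "case_nat (a + b) (\<lambda>N. f N + g N) = (\<lambda>N. case_nat a f N + case_nat b g N)"
    "case_nat (a * b) (\<lambda>N. f N * g N) = (\<lambda>N. case_nat a f N * case_nat b g N)"
    by (auto simp: fun_eq_iff split: nat.split)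
  then show "polyseq (case_nat (a + b) (\<lambda>N. f N + g N))" "polyseq (case_nat (a * b) (\<lambda>N. f N * g N))"
    using polyseq_add[OF assms] polyseq_mult[OF assms] by simp_all
qed

lemma omega_related_add:
  "omega_related f g \<Longrightarrow> omega_related f' g' \<Longrightarrow> omega_related (f + f') (g + g')"
  by (simp add: omega_related_def eval_sym_add polyseq_case_nat_op)

lemma omega_related_mult:
  "omega_related f g \<Longrightarrow> omega_related f' g' \<Longrightarrow> omega_related (f * f') (g * g')"
  by (simp add: omega_related_def eval_sym_mult polyseq_case_nat_op)

lemma omega_related_smult:
  assumes "omega_related f g"
  shows "omega_related (symfun_smult c f) (symfun_smult c g)"
proof -
  have const: "polyseq (case_nat (Poly_Mapping.single 0 c) (\<lambda>_. Poly_Mapping.single 0 c :: rpoly))"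
  proof -
    have "case_nat (Poly_Mapping.single 0 c) (\<lambda>_. Poly_Mapping.single 0 c :: rpoly)
        = (\<lambda>_. Poly_Mapping.single 0 c)"
      by (auto simp: fun_eq_iff split: nat.split)
    then show ?thesis by (simp only: polyseq_const)
  qed
  show ?thesis
    using assms polyseq_case_nat_op(2)[OF const] by (simp add: omega_related_def eval_sym_smult)
qed

lemma symfun_smult_minus_one: "symfun_smult (- 1) f = - f"
  by (rule symfun_eqI) (simp add: mcoeff_smult mcoeff_uminus)

lemma omega_related_uminus: "omega_related f g \<Longrightarrow> omega_related (- f) (- g)"
  using omega_related_smult[of f g "- 1"] by (simp add: symfun_smult_minus_one)

lemma omega_related_zero: "omega_related 0 0"
proof -
  have "eval_sym n v 0 = 0" for n v by (simp add: eval_sym_def)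
  moreover have "case_nat 0 (\<lambda>_. 0) = (\<lambda>_. 0 :: rpoly)" by (auto simp: fun_eq_iff split: nat.split)
  ultimately show ?thesis by (simp only: omega_related_def polyseq.zero simp_thms)
qed

lemma omega_related_sum:
  "(\<And>x. x \<in> S \<Longrightarrow> omega_related (f x) (g x)) \<Longrightarrow> omega_related (\<Sum>x\<in>S. f x) (\<Sum>x\<in>S. g x)"
  by (induction S rule: infinite_finite_induct) (auto intro: omega_related_zero omega_related_add)

text \<open>
  If all substitutions with multiplicity $N \ge 0$ vanish, so does the extension to $-1$, for each
  number $n$ of variables; and every coefficient of $g$ is seen with $n$ large enough.
\<close>

lemma omega_related_zero_left:
  assumes "omega_related 0 g"
  shows "g = 0"
proof (rule symfun_eqI)
  fix m :: monom
  obtain n where n: "Poly_Mapping.keys m \<subseteq> {..<n}"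
    using finite_nat_set_iff_bounded[of "Poly_Mapping.keys m"] by auto
  have "polyseq (case_nat (eval_sym n (signed_var (- 1)) g) (\<lambda>_. 0))"
    using assms by (simp add: omega_related_def eval_sym_def)
  from polyseq_eq_zero[OF this, of 0] have "eval_sym n (signed_var (- 1)) g = 0" by simp
  then have "Poly_Mapping.lookup (eval_sym n (signed_var (- 1)) g) m = 0" by simp
  then show "mcoeff g m = mcoeff 0 m"
    using n by (simp add: lookup_eval_sym_signed_var)
qed

lemma omega_related_unique:
  assumes "omega_related f g" "omega_related f g'"
  shows "g = g'"
  using omega_related_zero_left[of "g - g'"]
    omega_related_add[OF assms(1) omega_related_uminus[OF assms(2)]] by simp

text \<open>
  With $A = \prod_{i \le n} F(x_i t)$, multiplicity $N$ turns the generating function into $A^N$, while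
  $B = \prod_{i \le n} G(-x_i t)$ is $A^{-1}$.
\<close>

lemma omega_related_mult_sym:
  assumes F: "fps_nth F 0 = 1" and inv: "F * (G oo - fps_X) = 1"
  shows "omega_related (mult_sym F k) (mult_sym G k)"
  unfolding omega_related_def
proof
  fix n
  have G: "fps_nth G 0 = 1"
    using arg_cong[OF inv, of "\<lambda>H. fps_nth H 0"] F by simp
  define A where "A = (\<Prod>i<n. scaled_series F (signed_var 1 i))"
  define B where "B = (\<Prod>i<n. scaled_series G (signed_var (- 1) i))"
  have AB: "B * A = 1"
    unfolding A_def B_def scaled_series_neg_var prod.distrib[symmetric] scaled_series_mult[symmetric]
    using inv by (simp add: mult.commute scaled_series_one)
  have A0: "fps_nth A 0 = 1"
    unfolding A_def by (induction n) (simp_all add: scaled_series_def F)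
  have repeat: "(\<Prod>j<n * N. scaled_series F (signed_var 1 (j mod n))) = A ^ N" for N
  proof (induction N)
    case (Suc N)
    have "(\<Prod>j<n * Suc N. scaled_series F (signed_var 1 (j mod n))) =
        (\<Prod>j<n. scaled_series F (signed_var 1 (j mod n))) *
        (\<Prod>j=n..<n + n * N. scaled_series F (signed_var 1 (j mod n)))"
      unfolding lessThan_atLeast0 by (subst prod.atLeastLessThan_concat) simp_all
    also have "(\<Prod>j<n. scaled_series F (signed_var 1 (j mod n))) = A"
      unfolding A_def by (rule prod.cong) simp_all
    also have "(\<Prod>j=n..<n + n * N. scaled_series F (signed_var 1 (j mod n))) =
        (\<Prod>j<n * N. scaled_series F (signed_var 1 (j mod n)))"
      by (rule prod.reindex_bij_witness[of _ "\<lambda>j. j + n" "\<lambda>j. j - n"])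
         (auto simp: le_mod_geq)
    finally show ?case by (simp add: Suc.IH)
  qed simp
  have "case_nat (eval_sym n (signed_var (- 1)) (mult_sym G k))
      (\<lambda>N. eval_sym (n * N) (\<lambda>j. signed_var 1 (j mod n)) (mult_sym F k)) =
      (\<lambda>N. fps_nth (B * A ^ N) k)"
  proof
    fix N
    have "B * A ^ Suc M = A ^ M" for M
      using AB by (simp add: mult.assoc[symmetric])
    then show "case_nat (eval_sym n (signed_var (- 1)) (mult_sym G k))
      (\<lambda>N. eval_sym (n * N) (\<lambda>j. signed_var 1 (j mod n)) (mult_sym F k)) N = fps_nth (B * A ^ N) k"
      by (cases N) (simp_all add: eval_sym_mult_sym F G B_def[symmetric] repeat del: power_Suc)
  qed
  then show "polyseq (case_nat (eval_sym n (signed_var (- 1)) (mult_sym G k))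
      (\<lambda>N. eval_sym (n * N) (\<lambda>j. signed_var 1 (j mod n)) (mult_sym F k)))"
    by (simp only: polyseq_fps_nth_power[OF A0])
qed

section \<open>The elementary symmetric functions generate\<close>

text \<open>
  Padding both exponent vectors with zeros to the union of their supports turns equality of the
  exponent multisets into a permutation of that finite set of variables.
\<close>

lemma mcoeff_cong_exponents:
  assumes "exponents a = exponents b"
  shows "mcoeff f a = mcoeff f b"
proof -
  define A where "A = Poly_Mapping.keys a \<union> Poly_Mapping.keys b"
  have A: "finite A" by (simp add: A_def)
  have ext: "image_mset (Poly_Mapping.lookup c) (mset_set A) =
      exponents c + replicate_mset (card A - size (exponents c)) 0"
    if "Poly_Mapping.keys c \<subseteq> A" for c
  proof -
    have "mset_set A = mset_set (Poly_Mapping.keys c) + mset_set (A - Poly_Mapping.keys c)"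
      using that A by (subst mset_set_Union[symmetric]) (auto simp: Un_absorb1 intro: finite_subset)
    moreover have "image_mset (Poly_Mapping.lookup c) (mset_set (A - Poly_Mapping.keys c)) =
        image_mset (\<lambda>_. 0) (mset_set (A - Poly_Mapping.keys c))"
      by (rule image_mset_cong) (use A in \<open>simp add: in_keys_iff\<close>)
    ultimately show ?thesis
      using that by (simp add: exponents_def image_mset_const_eq card_Diff_subset)
  qed
  have "image_mset (Poly_Mapping.lookup a) (mset_set A) = image_mset (Poly_Mapping.lookup b) (mset_set A)"
    using assms by (subst (1 2) ext) (auto simp: A_def)
  then obtain p where p: "p permutes A" "\<forall>x\<in>A. Poly_Mapping.lookup a x = Poly_Mapping.lookup b (p x)"
    by (rule image_mset_eq_implies_permutes[OF A])
  have bij: "bij p" using p(1) by (rule permutes_bij)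
  have "a = Poly_Mapping.map_key p b"
  proof (rule poly_mapping_eqI)
    fix x
    show "Poly_Mapping.lookup a x = Poly_Mapping.lookup (Poly_Mapping.map_key p b) x"
    proof (cases "x \<in> A")
      case True
      then show ?thesis using p(2) by (simp add: lookup_map_key_bij[OF bij])
    next
      case False
      then have "p x = x" using p(1) by (simp add: permutes_def)
      then show ?thesis using False by (simp add: lookup_map_key_bij[OF bij] A_def in_keys_iff)
    qed
  qed
  then show ?thesis by (simp add: mcoeff_map_key[OF bij])
qed

definition indicator_monom :: "nat set \<Rightarrow> monom" where
  "indicator_monom T = (\<Sum>i\<in>T. Poly_Mapping.single i 1)"

lemma lookup_indicator_monom:
  "finite T \<Longrightarrow> Poly_Mapping.lookup (indicator_monom T) i = (if i \<in> T then 1 else 0)"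
  by (simp add: indicator_monom_def lookup_sum lookup_single when_def)

lemma keys_indicator_monom: "finite T \<Longrightarrow> Poly_Mapping.keys (indicator_monom T) = T"
  by (auto simp: in_keys_iff lookup_indicator_monom split: if_splits)

lemma mdeg_indicator_monom: "finite T \<Longrightarrow> mdeg (indicator_monom T) = card T"
  by (simp add: mdeg_def keys_indicator_monom lookup_indicator_monom)

lemma squarefree_monom_eq_indicator:
  assumes "\<forall>i. Poly_Mapping.lookup m i \<le> 1"
  shows "m = indicator_monom (Poly_Mapping.keys m)"
proof (rule poly_mapping_eqI)
  fix i
  show "Poly_Mapping.lookup m i = Poly_Mapping.lookup (indicator_monom (Poly_Mapping.keys m)) i"
    using assms[rule_format, of i] by (auto simp: lookup_indicator_monom in_keys_iff)
qed

lemma card_keys_squarefree: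
  assumes "\<forall>i. Poly_Mapping.lookup m i \<le> 1"
  shows "card (Poly_Mapping.keys m) = mdeg m"
  by (subst (2) squarefree_monom_eq_indicator[OF assms]) (simp add: mdeg_indicator_monom)

lemma exponents_add_indicator_monom:
  assumes T: "finite T" "Poly_Mapping.keys b \<subseteq> T"
  shows "exponents (b + indicator_monom T) =
    image_mset Suc (exponents b) + replicate_mset (card T - size (exponents b)) 1"
proof -
  have keys: "Poly_Mapping.keys (b + indicator_monom T) = T"
    using T keys_add[of b "indicator_monom T"]
    by (auto simp: in_keys_iff lookup_add lookup_indicator_monom keys_indicator_monom)
  have "mset_set T = mset_set (Poly_Mapping.keys b) + mset_set (T - Poly_Mapping.keys b)"
    using T by (subst mset_set_Union[symmetric]) (auto simp: Un_absorb1)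
  moreover have "exponents (b + indicator_monom T) =
      image_mset (\<lambda>i. Suc (Poly_Mapping.lookup b i)) (mset_set T)"
    unfolding exponents_def keys
    by (rule image_mset_cong) (use T in \<open>simp add: lookup_add lookup_indicator_monom\<close>)
  moreover have "image_mset (\<lambda>i. Suc (Poly_Mapping.lookup b i)) (mset_set (T - Poly_Mapping.keys b)) =
      image_mset (\<lambda>_. 1) (mset_set (T - Poly_Mapping.keys b))"
    by (rule image_mset_cong) (use T in \<open>simp add: in_keys_iff\<close>)
  ultimately show ?thesis
    using T by (simp add: exponents_def image_mset_const_eq card_Diff_subset multiset.map_comp comp_def)
qed

lemma superset_of_card:
  assumes "finite K" "card K \<le> l"
  obtains T :: "nat set" where "finite T" "card T = l" "K \<subseteq> T"
proof -
  have "infinite (UNIV - K)" using assms by (simp add: infinite_UNIV_nat)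
  then obtain B where B: "finite B" "card B = l - card K" "B \<subseteq> UNIV - K"
    by (meson infinite_arbitrarily_large)
  show ?thesis
  proof (rule that)
    show "card (K \<union> B) = l" using assms B by (subst card_Un_disjoint) auto
  qed (use assms B in auto)
qed

text \<open>
  If every monomial of $f$ involves at least $l$ variables, then the part of $f$ with exactly $l$
  variables, restricted to $x_1, \dots, x_l$, is divisible by $x_1 \cdots x_l$.  The quotient is
  symmetric in these $l$ variables; it lifts to a symmetric function $g$ whose monomials involve at
  most $l$ variables: the coefficient of $g$ at $x^b$ is that of $f$ at $x^b \prod_{i \in T} x_i$ for
  any $l$-element set $T$ of variables that contains those of $x^b$.  A monomial with exactly $l$
  variables occurs in $e_l g$ in one way only, with all of its variables taken from $e_l$, so
  $f - e_l g$ has only monomials in more than $l$ variables.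
\<close>

lemma divide_by_elem_sym:
  fixes f :: "'a :: comm_ring_1 symfun"
  assumes supp: "\<And>m. mcoeff f m \<noteq> 0 \<Longrightarrow> l \<le> card (Poly_Mapping.keys m)"
    and deg: "\<And>m. mcoeff f m \<noteq> 0 \<Longrightarrow> mdeg m \<le> d" and "0 < l" "l \<le> d"
  obtains g where "\<And>m. mcoeff g m \<noteq> 0 \<Longrightarrow> mdeg m \<le> d - l"
    and "\<And>m. mcoeff (f - elem_sym l * g) m \<noteq> 0 \<Longrightarrow> Suc l \<le> card (Poly_Mapping.keys m)"
    and "\<And>m. mcoeff (f - elem_sym l * g) m \<noteq> 0 \<Longrightarrow> mdeg m \<le> d"
proof -
  let ?sup = "\<lambda>b T. finite T \<and> card T = l \<and> Poly_Mapping.keys b \<subseteq> T"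
  define c where "c b = (if card (Poly_Mapping.keys b) \<le> l
      then mcoeff f (b + indicator_monom (SOME T. ?sup b T)) else 0)" for b :: monom
  have c_eq: "c b = mcoeff f (b + indicator_monom T)" if "?sup b T" for b T
  proof -
    have "?sup b (SOME T. ?sup b T)" using that by (rule someI)
    then have "exponents (b + indicator_monom (SOME T. ?sup b T)) = exponents (b + indicator_monom T)"
      using that by (simp add: exponents_add_indicator_monom)
    moreover have "card (Poly_Mapping.keys b) \<le> l"
      using that card_mono[of T "Poly_Mapping.keys b"] by simp
    ultimately show ?thesis
      using mcoeff_cong_exponents[of "b + indicator_monom (SOME T. ?sup b T)" "b + indicator_monom T" f]
      by (simp only: c_def if_True)
  qed
  have c_deg: "mdeg b \<le> d - l" if "c b \<noteq> 0" for b
  proof -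
    have "card (Poly_Mapping.keys b) \<le> l" using that by (simp add: c_def split: if_splits)
    then obtain T where T: "finite T" "card T = l" "Poly_Mapping.keys b \<subseteq> T"
      using superset_of_card[of "Poly_Mapping.keys b" l] by auto
    then have "mdeg (b + indicator_monom T) \<le> d" using that deg c_eq[of T b] by simp
    then show ?thesis using T by (simp add: mdeg_add mdeg_indicator_monom)
  qed
  have c_sym: "c (Poly_Mapping.map_key p b) = c b" if p: "bij p" for p b
  proof (cases "card (Poly_Mapping.keys b) \<le> l")
    case True
    have card: "card (Poly_Mapping.keys (Poly_Mapping.map_key p b)) = card (Poly_Mapping.keys b)"
      by (rule bij_betw_same_card[OF bij_betw_keys_map_key[OF p]])
    obtain T where T: "?sup b T" using superset_of_card[of "Poly_Mapping.keys b" l] True by auto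
    obtain U where U: "?sup (Poly_Mapping.map_key p b) U"
      using superset_of_card[of "Poly_Mapping.keys (Poly_Mapping.map_key p b)" l] True card by auto
    have "exponents (Poly_Mapping.map_key p b + indicator_monom U) = exponents (b + indicator_monom T)"
      using T U by (simp add: exponents_add_indicator_monom exponents_map_key[OF p])
    then show ?thesis unfolding c_eq[OF T] c_eq[OF U] by (rule mcoeff_cong_exponents)
  next
    case False
    then show ?thesis
      by (simp add: c_def bij_betw_same_card[OF bij_betw_keys_map_key[OF p]])
  qed
  define g where "g = Abs_symfun c"
  have g: "mcoeff g = c"
    unfolding g_def by (rule mcoeff_Abs_symfun, rule is_symfunI[of _ "d - l"]) (simp_all add: c_deg c_sym)
  have elem_keys: "card (Poly_Mapping.keys a) = l \<and> a = indicator_monom (Poly_Mapping.keys a)"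
    if "mcoeff (elem_sym l :: 'a symfun) a \<noteq> 0" for a
    using that card_keys_squarefree[of a] squarefree_monom_eq_indicator[of a]
    by (simp add: mcoeff_elem_sym split: if_splits)
  have prod_small: "mcoeff (elem_sym l * g) m = mcoeff f m"
    if m: "card (Poly_Mapping.keys m) \<le> l" for m
  proof (cases "card (Poly_Mapping.keys m) = l")
    case True
    let ?I = "indicator_monom (Poly_Mapping.keys m)"
    define b where "b = m - ?I"
    have mb: "?I + b = m"
      by (rule poly_mapping_eqI)
         (auto simp: b_def lookup_add lookup_minus lookup_indicator_monom in_keys_iff)
    have b_keys: "Poly_Mapping.keys b \<subseteq> Poly_Mapping.keys m"
      using keys_add_monom[of ?I b] mb by auto
    have only: "a = ?I" if "a + b' = m" "mcoeff (elem_sym l :: 'a symfun) a \<noteq> 0" for a b'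
    proof -
      have "Poly_Mapping.keys a \<subseteq> Poly_Mapping.keys m" using keys_add_monom[of a b'] that(1) by auto
      then have "Poly_Mapping.keys a = Poly_Mapping.keys m"
        by (rule card_subset_eq[rotated]) (use elem_keys[OF that(2)] True in simp_all)
      then show ?thesis using elem_keys[OF that(2)] by simp
    qed
    have "mcoeff (elem_sym l * g) m = (\<Sum>(a, b)\<in>{(?I, b)}. mcoeff (elem_sym l) a * mcoeff g b)"
      unfolding mcoeff_mult
    proof (rule sum.mono_neutral_right)
      show "\<forall>x\<in>{(a, b). a + b = m} - {(?I, b)}.
          (case x of (a, b) \<Rightarrow> mcoeff (elem_sym l) a * mcoeff g b) = 0"
      proof (intro ballI)
        fix x assume x: "x \<in> {(a, b). a + b = m} - {(?I, b)}"
        obtain a b' where [simp]: "x = (a, b')" by (cases x)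
        have "a \<noteq> ?I"
        proof
          assume "a = ?I"
          then have "?I + b' = ?I + b" using x mb by simp
          then have "b' = b" by (simp only: add_left_cancel)
          then show False using x \<open>a = ?I\<close> by simp
        qed
        then have "mcoeff (elem_sym l :: 'a symfun) a = 0" using only[of a b'] x by auto
        then show "(case x of (a, b) \<Rightarrow> mcoeff (elem_sym l) a * mcoeff g b) = 0" by simp
      qed
    qed (simp_all add: finite_add_decomps mb)
    also have "\<dots> = c b"
      by (simp add: g mcoeff_elem_sym mdeg_indicator_monom True lookup_indicator_monom)
    also have "\<dots> = mcoeff f (b + ?I)"
      by (rule c_eq) (simp add: True b_keys)
    finally show ?thesis using mb by (simp add: add.commute)
  next
    case False
    have "mcoeff (elem_sym l * g) m = 0"
    proof (rule ccontr)
      assume "mcoeff (elem_sym l * g) m \<noteq> 0"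
      then obtain a b where ab: "a + b = m" "mcoeff (elem_sym l :: 'a symfun) a \<noteq> 0"
        by (rule mcoeff_mult_nonzero)
      then have "card (Poly_Mapping.keys a) \<le> card (Poly_Mapping.keys m)"
        using keys_add_monom[of a b] by (auto intro: card_mono)
      then show False using elem_keys[OF ab(2)] m False by simp
    qed
    moreover have "mcoeff f m = 0" using supp[of m] m False by auto
    ultimately show ?thesis by simp
  qed
  have diff: "mcoeff (f - elem_sym l * g) m = mcoeff f m - mcoeff (elem_sym l * g) m" for m
    by (simp only: diff_conv_add_uminus mcoeff_add mcoeff_uminus)
  show thesis
  proof (rule that[of g])
    show "mdeg m \<le> d - l" if "mcoeff g m \<noteq> 0" for m using that by (simp add: g c_deg)
    show "Suc l \<le> card (Poly_Mapping.keys m)" if "mcoeff (f - elem_sym l * g) m \<noteq> 0" for m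
      using that prod_small[of m] by (cases "card (Poly_Mapping.keys m) \<le> l") (auto simp: diff)
    show "mdeg m \<le> d" if m: "mcoeff (f - elem_sym l * g) m \<noteq> 0" for m
    proof (cases "mcoeff f m = 0")
      case True
      then have "mcoeff (elem_sym l * g) m \<noteq> 0" using m by (simp add: diff)
      then obtain a b where ab: "a + b = m" "mcoeff (elem_sym l :: 'a symfun) a \<noteq> 0" "mcoeff g b \<noteq> 0"
        by (rule mcoeff_mult_nonzero)
      then have "mdeg a = l" "mdeg b \<le> d - l"
        using c_deg[of b] by (auto simp: mcoeff_elem_sym g split: if_splits)
      then show ?thesis using ab(1) \<open>l \<le> d\<close> by (auto simp: mdeg_add)
    qed (use deg in auto)
  qed
qed

lemma card_keys_le_mdeg: "card (Poly_Mapping.keys m) \<le> mdeg m"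
proof -
  have "(\<Sum>i\<in>Poly_Mapping.keys m. 1) \<le> mdeg m"
    unfolding mdeg_def by (rule sum_mono) (simp add: in_keys_iff Suc_le_eq)
  then show ?thesis by simp
qed

lemma elem_sym_0: "elem_sym 0 = (1 :: 'a :: comm_ring_1 symfun)"
  by (rule symfun_eqI) (auto simp: mcoeff_elem_sym mcoeff_one mdeg_eq_0_iff)

lemma mcoeff_of_int: "mcoeff (of_int z) m = (if m = 0 then of_int z else (0 :: 'a :: comm_ring_1))"
proof -
  have nat: "mcoeff (of_nat n) m = (if m = 0 then of_nat n else (0 :: 'a))" for n
    by (induction n) (simp_all add: mcoeff_add mcoeff_one)
  show ?thesis
    by (cases z rule: int_diff_cases)
       (simp add: diff_conv_add_uminus mcoeff_add mcoeff_uminus nat del: add_uminus_conv_diff)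
qed

text \<open>
  Induction on a degree bound $d$, and for given $d$ downwards on a lower bound $l \ge 1$ for the number
  of variables of the monomials of $f$: replacing $f$ by $f - e_l g$ raises $l$, the factor $g$ has
  smaller degree, and for $l > d$ nothing is left.  The constant term is split off first, since
  division by $e_0 = 1$ would not lower the degree.
\<close>

lemma elem_sym_generate:
  fixes f :: "int symfun"
  assumes elem: "\<And>k. P (elem_sym k)" and add: "\<And>f g. P f \<Longrightarrow> P g \<Longrightarrow> P (f + g)"
    and mult: "\<And>f g. P f \<Longrightarrow> P g \<Longrightarrow> P (f * g)"
    and uminus: "\<And>f. P f \<Longrightarrow> P (- f)"
  shows "P f"
proof -
  have one: "P 1" using elem[of 0] by (simp add: elem_sym_0)
  have zero: "P 0" using add[OF one uminus[OF one]] by simp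
  have "P (of_nat n)" for n by (induction n) (simp_all add: zero one add)
  then have const: "P (of_int z)" for z
    by (cases z rule: int_diff_cases)
       (simp add: diff_conv_add_uminus add uminus del: add_uminus_conv_diff)
  have main: "\<forall>f. (\<forall>m. mcoeff f m \<noteq> 0 \<longrightarrow> mdeg m \<le> d) \<longrightarrow> P f" for d
  proof (induction d rule: less_induct)
    case (less d)
    have step: "P f" if "0 < l" "\<forall>m. mcoeff f m \<noteq> 0 \<longrightarrow> mdeg m \<le> d"
        "\<forall>m. mcoeff f m \<noteq> 0 \<longrightarrow> l \<le> card (Poly_Mapping.keys m)" for f l
      using that
    proof (induction "Suc d - l" arbitrary: l f)
      case 0
      have "f = 0"
      proof (rule symfun_eqI)
        fix m
        show "mcoeff f m = mcoeff 0 m"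
          using 0 card_keys_le_mdeg[of m] by fastforce
      qed
      then show ?case by (simp add: zero)
    next
      case (Suc x)
      then have l: "0 < l" "l \<le> d" by auto
      obtain g where g: "\<And>m. mcoeff g m \<noteq> 0 \<Longrightarrow> mdeg m \<le> d - l"
          "\<And>m. mcoeff (f - elem_sym l * g) m \<noteq> 0 \<Longrightarrow> Suc l \<le> card (Poly_Mapping.keys m)"
          "\<And>m. mcoeff (f - elem_sym l * g) m \<noteq> 0 \<Longrightarrow> mdeg m \<le> d"
        by (rule divide_by_elem_sym[of f l d]) (use Suc.prems l in auto)
      have "P (f - elem_sym l * g)"
        by (rule Suc.hyps(1)[of "Suc l"]) (use Suc.hyps(2) g in auto)
      moreover have "P g" using less[of "d - l"] l g(1) by auto
      ultimately have "P ((f - elem_sym l * g) + elem_sym l * g)"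
        by (intro add mult elem)
      then show ?case by simp
    qed
    show ?case
    proof (intro allI impI)
      fix f :: "int symfun" assume f: "\<forall>m. mcoeff f m \<noteq> 0 \<longrightarrow> mdeg m \<le> d"
      define h where "h = f + - of_int (mcoeff f 0)"
      have h: "mcoeff h m = (if m = 0 then 0 else mcoeff f m)" for m
        by (simp only: h_def mcoeff_add mcoeff_uminus mcoeff_of_int) simp
      have "P h"
        by (rule step[of 1]) (use f in \<open>auto simp: h Suc_le_eq card_gt_0_iff split: if_splits\<close>)
      then have "P (h + of_int (mcoeff f 0))" by (intro add const)
      then show "P f" by (simp add: h_def)
    qed
  qed
  obtain d where "\<And>m. mcoeff f m \<noteq> 0 \<Longrightarrow> mdeg m \<le> d" by (rule mcoeff_bounded[of f]) blast
  then show ?thesis using main[of d] by blast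
qed

section \<open>Identification of the involution\<close>

lemma symfun_rat_add: "symfun_rat (f + g) = symfun_rat f + symfun_rat g"
  by (rule symfun_eqI) (simp add: mcoeff_symfun_rat mcoeff_add)

lemma symfun_rat_uminus: "symfun_rat (- f) = - symfun_rat f"
  by (rule symfun_eqI) (simp add: mcoeff_symfun_rat mcoeff_uminus)

lemma symfun_rat_mult: "symfun_rat (f * g) = symfun_rat f * symfun_rat g"
  by (rule symfun_eqI) (simp add: mcoeff_symfun_rat mcoeff_mult case_prod_beta)

lemma symfun_rat_inject: "symfun_rat f = symfun_rat g \<Longrightarrow> f = g"
  by (rule symfun_eqI) (metis mcoeff_symfun_rat of_int_eq_iff)

lemma elem_sym_eq_mult_sym: "symfun_rat (elem_sym k) = mult_sym (1 + fps_X) k"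
proof (rule symfun_eqI)
  fix m :: monom
  have nth: "fps_nth (1 + fps_X :: rat fps) j = (if j \<le> 1 then 1 else 0)" for j
    by (cases j) (auto simp: fps_X_def)
  show "mcoeff (symfun_rat (elem_sym k)) m = mcoeff (mult_sym (1 + fps_X) k) m"
  proof (cases "\<forall>i. Poly_Mapping.lookup m i \<le> 1")
    case True
    then have "(\<Prod>i\<in>Poly_Mapping.keys m. fps_nth (1 + fps_X :: rat fps) (Poly_Mapping.lookup m i)) = 1"
      by (intro prod.neutral ballI) (simp only: nth if_True)
    then show ?thesis
      using True by (simp only: mcoeff_symfun_rat mcoeff_elem_sym mcoeff_mult_sym) simp
  next
    case False
    then obtain i where i: "\<not> Poly_Mapping.lookup m i \<le> 1" by blast
    then have "i \<in> Poly_Mapping.keys m" by (auto simp: in_keys_iff)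
    then have "(\<Prod>i\<in>Poly_Mapping.keys m. fps_nth (1 + fps_X :: rat fps) (Poly_Mapping.lookup m i)) = 0"
      using i by (intro prod_zero bexI[of _ i]) (simp_all only: nth if_False finite_keys)
    then show ?thesis
      using False by (simp only: mcoeff_symfun_rat mcoeff_elem_sym mcoeff_mult_sym) simp
  qed
qed

lemma complete_sym_eq_mult_sym: "symfun_rat (complete_sym k) = mult_sym (Abs_fps (\<lambda>_. 1)) k"
  by (rule symfun_eqI) (simp add: mcoeff_symfun_rat mcoeff_complete_sym mcoeff_mult_sym)

lemma omega_related_elem_complete:
  "omega_related (symfun_rat (elem_sym k)) (symfun_rat (complete_sym k))"
  unfolding elem_sym_eq_mult_sym complete_sym_eq_mult_sym
proof (rule omega_related_mult_sym)
  show "(1 + fps_X) * (Abs_fps (\<lambda>_. 1) oo - fps_X) = (1 :: rat fps)"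
  proof (rule fps_ext)
    fix j
    show "fps_nth ((1 + fps_X) * (Abs_fps (\<lambda>_. 1) oo - fps_X)) j = fps_nth (1 :: rat fps) j"
      by (cases j) (simp_all add: fps_compose_uminus' distrib_right)
  qed
qed simp

text \<open>
  That \<open>g\<close> can be taken with integral coefficients comes from generation over $\mathbb{Z}$ and the
  integrality of the $h_k$.
\<close>

lemma ex_omega_related: "\<exists>g. omega_related (symfun_rat f) (symfun_rat g)"
proof (induction f rule: elem_sym_generate)
  case (1 k)
  then show ?case using omega_related_elem_complete by blast
next
  case (2 f g)
  then show ?case using omega_related_add symfun_rat_add by metis
next
  case (3 f g)
  then show ?case using omega_related_mult symfun_rat_mult by metis
next
  case (4 f)
  then show ?case using omega_related_uminus symfun_rat_uminus by metis
qed

lemma omega_related_omega: "omega_related (symfun_rat f) (symfun_rat (omega f))"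
proof -
  define W where "W f = (SOME g. omega_related (symfun_rat f) (symfun_rat g))" for f
  have W: "omega_related (symfun_rat f) (symfun_rat (W f))" for f
    unfolding W_def by (rule someI_ex) (rule ex_omega_related)
  have W_eq: "W f = g" if "omega_related (symfun_rat f) (symfun_rat g)" for f g
    by (rule symfun_rat_inject) (rule omega_related_unique[OF W that])
  have W_elem: "W (elem_sym k) = complete_sym k" for k
    by (rule W_eq) (rule omega_related_elem_complete)
  have W_add: "W (f + g) = W f + W g" for f g
    by (rule W_eq) (simp only: symfun_rat_add omega_related_add W)
  have W_mult: "W (f * g) = W f * W g" for f g
    by (rule W_eq) (simp only: symfun_rat_mult omega_related_mult W)
  have "complete_sym 0 = (1 :: int symfun)"
    by (rule symfun_eqI) (simp add: mcoeff_complete_sym mcoeff_one mdeg_eq_0_iff)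
  then have W_one: "W 1 = 1"
    using W_elem[of 0] by (simp add: elem_sym_0)
  have "omega = W"
    unfolding omega_def
  proof (rule the_equality)
    fix w :: "int symfun \<Rightarrow> int symfun"
    assume w: "w 1 = 1 \<and> (\<forall>f g. w (f + g) = w f + w g) \<and>
      (\<forall>f g. w (f * g) = w f * w g) \<and> (\<forall>k. w (elem_sym k) = complete_sym k)"
    have uminus: "v (- f) = - v f" if "\<forall>f g. v (f + g) = v f + v g"
      for v :: "int symfun \<Rightarrow> int symfun" and f
    proof -
      have "v 0 = 0" using that[rule_format, of 0 0] by simp
      then show ?thesis
        using that[rule_format, of f "- f"] by (simp add: eq_neg_iff_add_eq_0 add.commute)
    qed
    have "w f = W f" for f
    proof (induction f rule: elem_sym_generate)
      case (4 f)
      then show ?case using uminus[of w f] uminus[of W f] w W_add by simp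
    qed (use w W_elem W_add W_mult in simp_all)
    then show "w = W" ..
  qed (simp add: W_elem W_add W_mult W_one)
  then show ?thesis using W by simp
qed

section \<open>Expansion in monomial symmetric functions\<close>

lemma finite_partitions: "finite (partitions k)"
proof (rule finite_subset)
  show "partitions k \<subseteq> {l. set l \<subseteq> {..k} \<and> length l \<le> k}"
  proof
    fix l assume l: "l \<in> partitions k"
    then have "length l \<le> sum_list l"
      unfolding partitions_def by (induction l arbitrary: k) (auto simp: Suc_le_eq intro: add_less_le_mono)
    then show "l \<in> {l. set l \<subseteq> {..k} \<and> length l \<le> k}"
      using l member_le_sum_list[of _ l] by (auto simp: partitions_def)
  qed
  show "finite {l. set l \<subseteq> {..k} \<and> length l \<le> k}"
    by (rule finite_lists_length_le) simp
qed

lemma partition_mset_inject: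
  assumes "l \<in> partitions k" "l' \<in> partitions k'" "mset l = mset l'"
  shows "l = l'"
proof -
  have "sorted (rev l)" "sorted (rev l')"
    using assms by (simp_all add: partitions_def sorted_wrt_rev)
  then have "rev l = rev l'"
    by (metis assms(3) mset_rev properties_for_sort)
  then show ?thesis by simp
qed

lemma exponents_partition:
  obtains l where "l \<in> partitions (mdeg m)" "mset l = exponents m"
proof
  let ?l = "rev (sorted_list_of_multiset (exponents m))"
  show l: "mset ?l = exponents m" by simp
  have "sum_list ?l = mdeg m" by (simp add: sum_mset_exponents[symmetric] sum_mset_sum_list[symmetric])
  moreover have "\<forall>i\<in>set ?l. i > 0"
    by (auto simp: exponents_def in_keys_iff)
  ultimately show "?l \<in> partitions (mdeg m)"
    by (simp add: partitions_def sorted_wrt_rev)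
qed

lemma mult_sym_eq_sum_monomial_sym:
  "mult_sym F k = (\<Sum>l\<in>partitions k. symfun_smult (\<Prod>i\<leftarrow>l. fps_nth F i) (monomial_sym l))"
proof (rule symfun_eqI)
  fix m
  have sum: "mcoeff (\<Sum>l\<in>S. f l) m = (\<Sum>l\<in>S. mcoeff (f l) m)"
    for S :: "nat list set" and f :: "nat list \<Rightarrow> 'a symfun"
    by (induction S rule: infinite_finite_induct) (simp_all add: mcoeff_add)
  obtain p where p: "p \<in> partitions (mdeg m)" "mset p = exponents m"
    by (rule exponents_partition)
  have "mcoeff (\<Sum>l\<in>partitions k. symfun_smult (\<Prod>i\<leftarrow>l. fps_nth F i) (monomial_sym l)) m =
      (\<Sum>l\<in>partitions k. if l = p then \<Prod>i\<leftarrow>p. fps_nth F i else 0)"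
    unfolding sum
  proof (rule sum.cong[OF refl])
    fix l assume "l \<in> partitions k"
    then have "exponents m = mset l \<longleftrightarrow> l = p" using p partition_mset_inject by metis
    then show "mcoeff (symfun_smult (\<Prod>i\<leftarrow>l. fps_nth F i) (monomial_sym l)) m =
        (if l = p then \<Prod>i\<leftarrow>p. fps_nth F i else 0)"
      by (simp add: mcoeff_smult mcoeff_monomial_sym)
  qed
  also have "\<dots> = (if p \<in> partitions k then \<Prod>i\<leftarrow>p. fps_nth F i else 0)"
    by (simp add: finite_partitions)
  also have "p \<in> partitions k \<longleftrightarrow> mdeg m = k"
    using p(1) by (auto simp: partitions_def)
  also have "(\<Prod>i\<leftarrow>p. fps_nth F i) = (\<Prod>i\<in>Poly_Mapping.keys m. fps_nth F (Poly_Mapping.lookup m i))"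
  proof -
    have "(\<Prod>i\<leftarrow>p. fps_nth F i) = prod_mset (image_mset (fps_nth F) (mset p))"
      by (simp only: mset_map[symmetric] prod_mset_prod_list)
    then show ?thesis
      by (simp add: p(2) exponents_def multiset.map_comp prod_unfold_prod_mset comp_def)
  qed
  finally show "mcoeff (mult_sym F k) m =
      mcoeff (\<Sum>l\<in>partitions k. symfun_smult (\<Prod>i\<leftarrow>l. fps_nth F i) (monomial_sym l)) m"
    by (simp add: mcoeff_mult_sym)
qed

section \<open>The Todd symmetric functions\<close>

lemma monom_with_initial_keys:
  obtains m' where "exponents m' = exponents m" "Poly_Mapping.keys m' = {..<card (Poly_Mapping.keys m)}"
proof -
  let ?K = "Poly_Mapping.keys m"
  obtain h where h: "bij_betw h {..<card ?K} ?K"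
    using ex_bij_betw_nat_finite[of ?K] by (auto simp: lessThan_atLeast0)
  define m' where "m' = (\<Sum>i<card ?K. Poly_Mapping.single i (Poly_Mapping.lookup m (h i)))"
  have l: "Poly_Mapping.lookup m' i = (if i < card ?K then Poly_Mapping.lookup m (h i) else 0)" for i
    by (simp add: m'_def lookup_sum lookup_single when_def)
  have k: "Poly_Mapping.keys m' = {..<card ?K}"
    using bij_betwE[OF h] by (auto simp: in_keys_iff l split: if_splits)
  have "exponents m' = image_mset (Poly_Mapping.lookup m) (image_mset h (mset_set {..<card ?K}))"
    unfolding exponents_def k multiset.map_comp by (rule image_mset_cong) (simp add: l)
  also have "image_mset h (mset_set {..<card ?K}) = mset_set ?K"
    using h by (simp add: bij_betw_def image_mset_mset_set)
  finally show ?thesis using k that by (simp add: exponents_def)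
qed

text \<open>
  A monomial of degree $k$ has at most $k$ variables, so by symmetry its coefficient can be read off
  in the first $k$ variables.
\<close>

lemma homogeneous_eqI:
  assumes "homogeneous k f" "homogeneous k g" "restrict_vars k f = restrict_vars k g"
  shows "f = g"
proof (rule symfun_eqI)
  fix m
  show "mcoeff f m = mcoeff g m"
  proof (cases "mdeg m = k")
    case True
    obtain m' where m': "exponents m' = exponents m"
        "Poly_Mapping.keys m' = {..<card (Poly_Mapping.keys m)}"
      by (rule monom_with_initial_keys)
    have "Poly_Mapping.keys m' \<subseteq> {..<k}"
      using m'(2) True card_keys_le_mdeg[of m] by auto
    then have "mcoeff f m' = mcoeff g m'"
      using arg_cong[OF assms(3), of "\<lambda>p. Poly_Mapping.lookup p m'"] by (simp add: lookup_restrict_vars)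
    then show ?thesis
      by (simp only: mcoeff_cong_exponents[OF m'(1)])
  next
    case False
    then have "mcoeff f m = 0" "mcoeff g m = 0" using assms(1,2) by (auto simp: homogeneous_def)
    then show ?thesis by simp
  qed
qed

text \<open>
  The quotient that defines the series is exact because $1 - e^{-t}$ has order $1$.
\<close>

lemma todd_series_times_denominator: "todd_series * (1 - fps_exp (- 1)) = fps_X"
proof -
  have "fps_nth (1 - fps_exp (- 1) :: rat fps) 1 \<noteq> 0" by simp
  then have "subdegree (1 - fps_exp (- 1) :: rat fps) \<le> 1" by (rule subdegree_leI)
  then have "(1 - fps_exp (- 1) :: rat fps) dvd fps_X"
    by (subst fps_dvd_iff) (auto simp: fps_eq_iff intro: exI[of _ 1])
  then show ?thesis by (simp add: todd_series_def)
qed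

lemma todd_series_nth_0: "fps_nth todd_series 0 = 1"
  using arg_cong[OF todd_series_times_denominator, of "\<lambda>F. fps_nth F 1"]
  by (simp add: fps_mult_nth)

lemma todd_sym_eq_mult_sym: "todd_sym k = mult_sym todd_series k"
  unfolding todd_sym_def
proof (rule the_equality)
  have "todd_factor i = scaled_series todd_series (signed_var 1 i)" for i
    by (rule fps_ext)
       (simp add: todd_factor_def scaled_series_def signed_var_def single_power[simplified] mult_single)
  then have "restrict_vars k (mult_sym todd_series k) = todd_poly k k"
    by (simp add: todd_poly_def restrict_vars_eq_eval_sym eval_sym_mult_sym todd_series_nth_0)
  moreover have "homogeneous k (mult_sym todd_series k)"
    by (simp add: homogeneous_def mcoeff_mult_sym)
  ultimately show *: "homogeneous k (mult_sym todd_series k) \<and>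
      restrict_vars k (mult_sym todd_series k) = todd_poly k k" by simp
  show "f = mult_sym todd_series k" if "homogeneous k f \<and> restrict_vars k f = todd_poly k k" for f
    by (rule homogeneous_eqI[of k]) (use that * in simp_all)
qed

text \<open>The series $(e^t - 1) / t$.\<close>

definition exp_quotient :: "rat fps" where
  "exp_quotient = Abs_fps (\<lambda>j. 1 / fact (j + 1))"

lemma exp_quotient_times_todd: "exp_quotient * (todd_series oo - fps_X) = 1"
proof -
  have E: "fps_X * exp_quotient = fps_exp 1 - 1"
  proof (rule fps_ext)
    fix j show "fps_nth (fps_X * exp_quotient) j = fps_nth (fps_exp 1 - 1) j"
      by (cases j) (simp_all add: exp_quotient_def del: fact_Suc)
  qed
  have "(todd_series oo - fps_X) * (1 - fps_exp 1) = - fps_X"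
    using arg_cong[OF todd_series_times_denominator, of "\<lambda>F. F oo - fps_X"]
    by (simp add: fps_compose_mult_distrib fps_compose_sub_distrib)
  also have "1 - fps_exp 1 = - (fps_X * exp_quotient)" unfolding E by simp
  finally have "fps_X * (exp_quotient * (todd_series oo - fps_X)) = fps_X * 1"
    by (simp add: mult_ac)
  then show ?thesis by (simp only: mult_cancel_left fps_X_neq_zero) simp
qed

lemma omega_related_todd: "omega_related (mult_sym exp_quotient k) (todd_sym k)"
  unfolding todd_sym_eq_mult_sym
  by (rule omega_related_mult_sym[OF _ exp_quotient_times_todd]) (simp add: exp_quotient_def)

theorem theorem1p2:
  fixes k :: nat
  shows "todd_sym k =
    (\<Sum>l\<in>partitions k. symfun_smult (1 / (\<Prod>i\<leftarrow>l. fact (i + 1))) (symfun_rat (forgotten_sym l)))"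
proof -
  let ?c = "\<lambda>l. 1 / (\<Prod>i\<leftarrow>l. fact (i + 1)) :: rat"
  have c: "(\<Prod>i\<leftarrow>l. fps_nth exp_quotient i) = ?c l" for l
    by (induction l) (simp_all add: exp_quotient_def)
  have m: "monomial_sym l = symfun_rat (monomial_sym l)" for l
    by (rule symfun_eqI) (simp add: mcoeff_symfun_rat mcoeff_monomial_sym)
  have "omega_related (mult_sym exp_quotient k)
      (\<Sum>l\<in>partitions k. symfun_smult (?c l) (symfun_rat (forgotten_sym l)))"
    unfolding mult_sym_eq_sum_monomial_sym c forgotten_sym_def
    by (intro omega_related_sum omega_related_smult) (subst m, rule omega_related_omega)
  with omega_related_todd show ?thesis by (rule omega_related_unique)
qed

end
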